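(* Let $f\in\mathbb{R}[x_1,\ldots,x_n]$ be nonnegative with global minimum $f^*:=\inf_{x\in\mathbb{R}^n}f(x)$, that is, $0\le f^*\le f(x)$ for all $x\in\mathbb{R}^n$. (i) There exist $r_0\in\mathbb{N}$ and $\lambda_0\ge 0$ such that, for all integers $r\ge r_0$ and all real $\lambda\ge\lambda_0$, the polynomial $$f+\lambda\sum_{k=0}^{r}\sum_{j=1}^n\frac{x_j^{2k}}{k!}$$ is a sum of squares. (ii) For every $\epsilon>0$ there is some $r_\epsilon\in\mathbb{N}$ such that $$f_\epsilon:=f+\epsilon\sum_{k=0}^{r_\epsilon}\sum_{j=1}^n\frac{x_j^{2k}}{k!}$$ is a sum of squares. Hence, $\|f-f_\epsilon\|_1\to 0$ as $\epsilon\downarrow 0$.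
   Context: A polynomial is a sum of squares (s.o.s.) if it is a finite sum of squares of polynomials in $\mathbb{R}[x_1,\ldots,x_n]$. For $f=\sum_{\alpha\in\mathbb{N}^n}f_\alpha x^\alpha\in\mathbb{R}[x_1,\ldots,x_n]$ (written in the canonical monomial basis), $\|f\|_1:=\sum_{\alpha\in\mathbb{N}^n}|f_\alpha|$. Here $\mathbb{N}=\{0,1,2,\ldots\}$, and $x_j^0=1$. The infimum $f^*$ is not required to be attained. *)

theory Defs
  imports "HOL-Analysis.Analysis" "HOL-Library.Poly_Mapping"
begin

text \<open>
  The ring R[x_1, ..., x_n] of real polynomials is rendered by finitely supported
  coefficient families: the finite type \<open>'n\<close> indexes the variables (so n is
  \<open>CARD('n)\<close>), \<open>'n \<Rightarrow>\<^sub>0 nat\<close> is the type of exponents, and the product of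
  \<^theory>\<open>HOL-Library.Poly_Mapping\<close> is the convolution product.
\<close>

type_synonym 'n rpoly = "('n \<Rightarrow>\<^sub>0 nat) \<Rightarrow>\<^sub>0 real"

definition Const :: "real \<Rightarrow> 'n rpoly" where
  "Const c = Poly_Mapping.single 0 c"

definition Var :: "'n \<Rightarrow> 'n rpoly" where
  "Var j = Poly_Mapping.single (Poly_Mapping.single j 1) 1"

definition eval_poly :: "'n::finite rpoly \<Rightarrow> real ^ 'n \<Rightarrow> real" where
  "eval_poly f x =
     (\<Sum>\<alpha>\<in>Poly_Mapping.keys f. Poly_Mapping.lookup f \<alpha> * (\<Prod>j\<in>UNIV. (x $ j) ^ Poly_Mapping.lookup \<alpha> j))"

definition l1_norm :: "'n rpoly \<Rightarrow> real" where
  "l1_norm f = (\<Sum>\<alpha>\<in>Poly_Mapping.keys f. \<bar>Poly_Mapping.lookup f \<alpha>\<bar>)"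

text \<open>A list rather than a set of summands, so that squares may be repeated.\<close>

definition sos :: "'n rpoly \<Rightarrow> bool" where
  "sos p \<longleftrightarrow> (\<exists>qs :: 'n rpoly list. p = (\<Sum>q\<leftarrow>qs. q ^ 2))"

text \<open>The infimum is taken in the reals, so it is meaningful only when \<open>f\<close> is bounded below.\<close>

definition global_inf :: "'n::finite rpoly \<Rightarrow> real" where
  "global_inf f = (INF x. eval_poly f x)"

definition exp_sum :: "nat \<Rightarrow> 'n::finite rpoly" where
  "exp_sum r = (\<Sum>k=0..r. \<Sum>j\<in>UNIV. Const (1 / fact k) * Var j ^ (2 * k))"

lemma global_inf_nonneg_iff:
  "(0 \<le> global_inf f \<and> (\<forall>x. global_inf f \<le> eval_poly f x)) \<longleftrightarrow> (\<forall>x. 0 \<le> eval_poly f x)"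
proof
  assume "0 \<le> global_inf f \<and> (\<forall>x. global_inf f \<le> eval_poly f x)"
  then show "\<forall>x. 0 \<le> eval_poly f x"
    using order_trans by blast
next
  assume nonneg: "\<forall>x. 0 \<le> eval_poly f x"
  have "bdd_below (range (eval_poly f))"
    using nonneg by (intro bdd_belowI[of _ 0]) auto
  then have "\<forall>x. global_inf f \<le> eval_poly f x"
    unfolding global_inf_def by (auto intro: cINF_lower)
  moreover have "0 \<le> global_inf f"
    unfolding global_inf_def using nonneg by (intro cINF_greatest) auto
  ultimately show "0 \<le> global_inf f \<and> (\<forall>x. global_inf f \<le> eval_poly f x)"
    by blast
qed

end

theory Submission
  imports Defs "HOL-Computational_Algebra.Polynomial"
begin

text \<open>
  Part (i) holds because, by the arithmetic-geometric mean inequality in sum-of-squares form,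
  each monomial is dominated up to sign by a multiple of \<open>exp_sum r\<close>, once \<open>r\<close> is large. Even a sum of
  monomials with coefficients of size \<open>\<eta> \<cdot> \<rho>\<^sup>k / sqrt (k!)\<close> in each variable is dominated by
  \<open>O(\<eta>) \<cdot> exp_sum r\<close> with a bound that does not depend on its degree, if \<open>\<rho>\<close> is a small constant.

  Part (ii) is proved constructively, without moment problems: it suffices to find a sum of squares \<open>Q\<close>
  that differs from \<open>f + \<delta>\<close> by such a small sum. On the box \<open>[-R, R]\<^sup>n\<close> the polynomial \<open>f + \<delta>\<close> is positive,
  so its Bernstein expansion of large degree \<open>N\<close> in the forms \<open>R - y\<^sub>j\<close>, \<open>R + y\<^sub>j\<close> has nonnegative coefficients.
  Substituting \<open>y\<^sub>j = R sin (x\<^sub>j / R)\<close>, which is close to \<open>x\<^sub>j\<close> coefficientwise for large \<open>R\<close>, turns both forms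
  into squares, since \<open>1 + sin (2u) = (cos u + sin u)\<^sup>2\<close> and \<open>1 - sin (2u) = (cos u - sin u)\<^sup>2\<close>.
  To stay with polynomials, replace \<open>cos u\<close> and \<open>sin u\<close> by the real and imaginary part of \<open>(1 + i u / N)\<^sup>N\<close>;
  their squares then add up to \<open>(1 + (u / N)\<^sup>2)\<^sup>N\<close> instead of \<open>1\<close>, which is compensated by
  homogenizing the Bernstein expansion.
\<close>

subsection \<open>The cone of sums of squares and domination\<close>

lemma Const_0 [simp]: "Const 0 = 0"
  by (simp add: Const_def)

lemma Const_1 [simp]: "Const 1 = 1"
  by (simp add: Const_def)

lemma Const_add: "Const (a + b) = Const a + Const b"
  by (simp add: Const_def single_add)

lemma Const_minus: "Const (- a) = - Const a"
  by (simp add: Const_def single_uminus)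

lemma Const_diff: "Const (a - b) = Const a - Const b"
  by (simp add: Const_def single_diff)

lemma Const_mult: "Const (a * b) = Const a * Const b"
  by (simp add: Const_def mult_single)

lemma Const_power: "Const (a ^ k) = Const a ^ k"
  by (induction k) (simp_all add: Const_mult)

lemma Const_sum: "Const (sum f A) = (\<Sum>x\<in>A. Const (f x))"
  by (induction A rule: infinite_finite_induct) (simp_all add: Const_add)

lemma Const_prod: "Const (prod f A) = (\<Prod>x\<in>A. Const (f x))"
  by (induction A rule: infinite_finite_induct) (simp_all add: Const_mult)

lemma sos_square: "sos (q ^ 2)"
  unfolding sos_def by (intro exI[of _ "[q]"]) simp

lemma sos_0 [simp]: "sos 0"
  unfolding sos_def by (intro exI[of _ "[]"]) simp

lemma sos_add: "sos p \<Longrightarrow> sos q \<Longrightarrow> sos (p + q)"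
  unfolding sos_def by (metis map_append sum_list_append)

lemma sos_sum: "(\<And>x. x \<in> A \<Longrightarrow> sos (f x)) \<Longrightarrow> sos (sum f A)"
  by (induction A rule: infinite_finite_induct) (auto intro: sos_add)

lemma sos_Const_mult:
  assumes "0 \<le> c" "sos p"
  shows "sos (Const c * p)"
proof -
  obtain qs where "p = (\<Sum>q\<leftarrow>qs. q ^ 2)"
    using assms(2) by (auto simp: sos_def)
  then have "Const c * p = (\<Sum>q\<leftarrow>map ((*) (Const (sqrt c))) qs. q ^ 2)"
    using assms(1)
    by (simp add: sum_list_const_mult o_def power_mult_distrib flip: Const_power)
  then show ?thesis
    unfolding sos_def by blast
qed

lemma sos_Const: "0 \<le> c \<Longrightarrow> sos (Const c)"
  using sos_Const_mult[of c "1 ^ 2"] sos_square[of 1] by simp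

lemma sos_Const_square: "0 \<le> c \<Longrightarrow> sos (Const c * q ^ 2)"
  by (intro sos_Const_mult sos_square)

text \<open>The certified form of |p| \<le> q. Being two-sided, it makes the signs of coefficients
  irrelevant when monomials are estimated.\<close>

definition dominated :: "'n rpoly \<Rightarrow> 'n rpoly \<Rightarrow> bool" where
  "dominated p q \<longleftrightarrow> sos (q - p) \<and> sos (q + p)"

lemma dominated_0: "sos q \<Longrightarrow> dominated 0 q"
  by (simp add: dominated_def)

lemma dominated_add:
  "dominated p q \<Longrightarrow> dominated p' q' \<Longrightarrow> dominated (p + p') (q + q')"
  unfolding dominated_def
  using sos_add[of "q - p" "q' - p'"] sos_add[of "q + p" "q' + p'"]
  by (simp add: algebra_simps)

lemma dominated_sum:
  "(\<And>x. x \<in> A \<Longrightarrow> dominated (f x) (g x)) \<Longrightarrow> dominated (sum f A) (sum g A)"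
  by (induction A rule: infinite_finite_induct) (auto intro: dominated_add dominated_0)

lemma dominated_mono: "dominated p q \<Longrightarrow> sos (q' - q) \<Longrightarrow> dominated p q'"
  unfolding dominated_def
  using sos_add[of "q - p" "q' - q"] sos_add[of "q + p" "q' - q"] by (simp add: algebra_simps)

lemma dominated_uminus: "dominated p q \<Longrightarrow> dominated (- p) q"
  by (simp add: dominated_def)

lemma dominated_Const_mult_nonneg:
  "0 \<le> c \<Longrightarrow> dominated p q \<Longrightarrow> dominated (Const c * p) (Const c * q)"
  unfolding dominated_def
  using sos_Const_mult[of c "q - p"] sos_Const_mult[of c "q + p"] by (simp add: algebra_simps)

lemma dominated_Const_mult:
  assumes "\<bar>c\<bar> \<le> d" "dominated p q" "sos q"
  shows "dominated (Const c * p) (Const d * q)"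
proof -
  have "dominated (Const \<bar>c\<bar> * p) (Const \<bar>c\<bar> * q)"
    using assms by (intro dominated_Const_mult_nonneg) auto
  moreover have "sos (Const d * q - Const \<bar>c\<bar> * q)"
    using sos_Const_mult[of "d - \<bar>c\<bar>" q] assms by (simp add: Const_diff algebra_simps)
  ultimately have "dominated (Const \<bar>c\<bar> * p) (Const d * q)"
    by (rule dominated_mono)
  then show ?thesis
    using dominated_uminus[of "Const \<bar>c\<bar> * p"] by (cases "0 \<le> c") (auto simp: Const_minus)
qed

lemma dominated_mult: "dominated (2 * u * v) (u ^ 2 + v ^ 2)"
  unfolding dominated_def using sos_square[of "u - v"] sos_square[of "u + v"]
  by (simp add: power2_eq_square algebra_simps)

lemma two_eq_Const: "2 = Const 2"
  using Const_add[of 1 1] by simp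

lemma Const_half_2: "Const (1/2) * 2 = 1"
  unfolding two_eq_Const by (simp flip: Const_mult)

lemma Const_half_mult:
  assumes "2 * p = q"
  shows "p = Const (1/2) * q"
  by (simp add: Const_half_2 flip: assms mult.assoc)

text \<open>A certificate for y \<le> 1 + y^(2^k) with y = a^2. Writing X for the power at k + 1,
  the induction step is 2(1 + X - y) = (1 + X - y^2) + (1 - y)^2 + X, whose first summand is the
  induction hypothesis for a^2 in place of a.\<close>

lemma sos_one_plus_power_diff:
  fixes a :: "'n rpoly"
  shows "sos (1 + (a ^ 2) ^ (2 ^ k) - a ^ 2)"
proof (induction k arbitrary: a)
  case 0
  then show ?case
    using sos_Const[of 1] by simp
next
  case (Suc k)
  define X where "X = (a ^ 2) ^ 2 ^ Suc k"
  have X: "X = ((a ^ 2) ^ 2) ^ 2 ^ k" "X = ((a ^ 2) ^ 2 ^ k) ^ 2"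
    by (simp_all add: X_def power_mult[symmetric] mult_ac)
  have "1 + X - a ^ 2 = Const (1/2) * ((1 + X - (a ^ 2) ^ 2) + (1 - a ^ 2) ^ 2 + X)"
    by (rule Const_half_mult) (simp add: power2_eq_square algebra_simps)
  moreover have "sos (1 + X - (a ^ 2) ^ 2)"
    unfolding X(1) by (rule Suc)
  moreover have "sos X"
    unfolding X(2) by (rule sos_square)
  ultimately have "sos (1 + X - a ^ 2)"
    by (simp only:) (intro sos_Const_mult sos_add sos_square, simp_all)
  then show ?case
    by (simp add: X_def)
qed

text \<open>An arithmetic-geometric mean bound with a convenient exponent: split off one factor by
  2uv \<le> u^2 + v^2 and apply the induction hypothesis to the squares of the remaining factors,
  which doubles the exponent.\<close>

lemma dominated_prod:
  fixes u :: "'a \<Rightarrow> 'n rpoly"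
  assumes "finite A"
  shows "dominated (\<Prod>j\<in>A. u j) (1 + (\<Sum>j\<in>A. u j ^ (2 ^ card A)))"
  using assms
proof (induction A arbitrary: u rule: finite_induct)
  case empty
  then show ?case
    using sos_Const[of 2] by (simp add: dominated_def two_eq_Const)
next
  case (insert i A)
  define v where "v = (\<Prod>j\<in>A. u j)"
  define P :: nat where "P = 2 ^ card (insert i A)"
  have pow: "(a ^ 2) ^ 2 ^ card A = a ^ P" for a :: "'n rpoly"
    using insert.hyps by (simp add: P_def flip: power_mult)
  have "dominated (\<Prod>j\<in>A. u j ^ 2) (1 + (\<Sum>j\<in>A. (u j ^ 2) ^ 2 ^ card A))"
    by (rule insert.IH)
  then have v: "sos (1 + (\<Sum>j\<in>A. u j ^ P) - v ^ 2)"
    by (simp add: dominated_def v_def prod_power_distrib pow)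
  have u: "sos (1 + u i ^ P - u i ^ 2)"
    using sos_one_plus_power_diff[of "u i" "card A"] by (simp add: pow)
  have P_even: "u j ^ P = (u j ^ 2 ^ card A) ^ 2" for j
    using insert.hyps by (simp add: P_def mult.commute flip: power_mult)
  have "dominated (2 * u i * v) (u i ^ 2 + v ^ 2)"
    by (rule dominated_mult)
  then have "dominated (2 * u i * v) (1 + u i ^ P + (1 + (\<Sum>j\<in>A. u j ^ P)))"
    using sos_add[OF u v] by (elim dominated_mono) (simp add: algebra_simps)
  \<comment> \<open>The slack is one more copy of the sum of the even powers \<open>u j ^ P\<close>;
    afterwards the factor 2 cancels.\<close>
  then have "dominated (2 * u i * v) (2 * (1 + (\<Sum>j\<in>insert i A. u j ^ P)))"
  proof (rule dominated_mono)
    have "sos (\<Sum>j\<in>insert i A. u j ^ P)"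
      unfolding P_even by (intro sos_sum sos_square)
    then show "sos (2 * (1 + (\<Sum>j\<in>insert i A. u j ^ P)) - 
        (1 + u i ^ P + (1 + (\<Sum>j\<in>A. u j ^ P))))"
      using insert.hyps by (simp add: algebra_simps)
  qed
  then have "dominated (Const (1/2) * (2 * u i * v))
      (Const (1/2) * (2 * (1 + (\<Sum>j\<in>insert i A. u j ^ P))))"
    by (intro dominated_Const_mult_nonneg) auto
  moreover have half: "Const (1/2) * (2 * q) = q" for q :: "'n rpoly"
    by (simp add: Const_half_2 flip: mult.assoc)
  ultimately have "dominated (u i * v) (1 + (\<Sum>j\<in>insert i A. u j ^ P))"
    by (simp only: half mult.assoc)
  then show ?case
    using insert.hyps by (simp add: v_def P_def)
qed

text \<open>Since ((h+1)k)! = k! (hk)! binom((h+1)k, k), each step of the induction on h costs only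
  a geometric factor. The bound converts 1/(k!)^h, which arises from powers of
  \<open>weight\<close>, into the coefficient 1/(hk)! of \<open>exp_sum\<close>.\<close>

lemma fact_mult_le:
  "\<exists>B::real \<ge> 1. \<forall>k. fact (h * k) \<le> B ^ k * fact k ^ h"
proof (induction h)
  case 0
  then show ?case
    by (intro exI[of _ 1]) auto
next
  case (Suc h)
  then obtain B :: real where B: "1 \<le> B" "\<And>k. fact (h * k) \<le> B ^ k * fact k ^ h"
    by blast
  have "fact (Suc h * k) \<le> (2 ^ Suc h * B) ^ k * fact k ^ Suc h" for k
  proof -
    have "real (Suc h * k choose k) \<le> 2 ^ (Suc h * k)"
      using of_nat_mono[OF binomial_le_pow2[of "Suc h * k" k], where 'a = real] by simp
    then have "(fact k * fact (h * k)) * real (Suc h * k choose k) \<le> 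
        (fact k * (B ^ k * fact k ^ h)) * 2 ^ (Suc h * k)"
      using B by (intro mult_mono) auto
    moreover have "fact (Suc h * k) = (fact k * fact (h * k)) * real (Suc h * k choose k)"
      using binomial_fact_lemma[of k "Suc h * k", THEN arg_cong[where f = real]]
      by simp
    ultimately show ?thesis
      by (simp add: power_mult_distrib power_mult[symmetric] power_add mult_ac)
  qed
  moreover have "1 \<le> 2 ^ Suc h * B"
    using B(1) by (metis mult_mono one_le_numeral one_le_power mult_1 zero_le_one zero_le_numeral zero_le_power)
  ultimately show ?case
    by blast
qed

section \<open>Weighted monomials and their domination by truncated exponential sums\<close>

definition monomial :: "('n::finite \<Rightarrow> nat) \<Rightarrow> 'n rpoly" where
  "monomial \<kappa> = (\<Prod>j\<in>UNIV. Var j ^ \<kappa> j)"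

text \<open>The scale of coefficients that \<open>exp_sum\<close> can absorb: the square of
  \<open>weight \<rho> k\<close> is a geometric factor times 1/k!, the coefficient of x^(2k) in
  \<open>exp_sum\<close>.\<close>

definition weight :: "real \<Rightarrow> nat \<Rightarrow> real" where
  "weight \<rho> k = \<rho> ^ k / sqrt (fact k)"

lemma weight_pos: "0 < \<rho> \<Longrightarrow> 0 < weight \<rho> k"
  by (simp add: weight_def)

lemma sos_exp_sum_diff:
  fixes a :: "'n::finite \<Rightarrow> real"
  assumes "\<And>j. 0 \<le> a j" "\<And>j. a j \<le> 1 / fact (k j)" "\<And>j. k j \<le> r"
  shows "sos (exp_sum r - (\<Sum>j\<in>UNIV. Const (a j) * Var j ^ (2 * k j)))"
proof -
  have "exp_sum r - (\<Sum>j\<in>UNIV. Const (a j) * Var j ^ (2 * k j)) =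
    (\<Sum>j\<in>UNIV. \<Sum>i=0..r. Const (1 / fact i - (if i = k j then a j else 0)) * (Var j ^ i) ^ 2)"
  proof -
    have "(\<Sum>i=0..r. Const (1 / fact i - (if i = k j then a j else 0)) * (Var j ^ i) ^ 2) =
       (\<Sum>i=0..r. Const (1 / fact i) * Var j ^ (2 * i)) - Const (a j) * Var j ^ (2 * k j)" for j
    proof -
      have "(\<Sum>i=0..r. Const (1 / fact i - (if i = k j then a j else 0)) * (Var j ^ i) ^ 2) =
         (\<Sum>i=0..r. Const (1 / fact i) * Var j ^ (2 * i)) - 
         (\<Sum>i=0..r. if i = k j then Const (a j) * Var j ^ (2 * k j) else 0)"
        unfolding sum_subtractf[symmetric]
        by (intro sum.cong refl) (auto simp: Const_diff algebra_simps mult.commute[of 2] power_mult)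
      then show ?thesis
        using assms(3)[of j] by (simp add: sum.delta)
    qed
    then show ?thesis
      unfolding exp_sum_def by (subst sum.swap) (simp add: sum_subtractf)
  qed
  moreover have "sos (\<Sum>j\<in>UNIV. \<Sum>i=0..r. 
      Const (1 / fact i - (if i = k j then a j else 0)) * (Var j ^ i) ^ 2)"
    using assms(1,2) by (intro sos_sum sos_Const_square) auto
  ultimately show ?thesis
    by simp
qed

lemma sos_exp_sum: "sos (exp_sum r :: 'n::finite rpoly)"
  using sos_exp_sum_diff[of "\<lambda>_::'n. 0" "\<lambda>_. 0"] by simp

lemma sos_exp_sum_diff_1: "sos (exp_sum r - 1 :: 'n::finite rpoly)"
proof -
  \<comment> \<open>Any index works: the k = 0 term of a single variable already contributes the
    constant 1.\<close>
  define i :: 'n where "i = undefined"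
  have "(\<Sum>j\<in>UNIV. Const (if j = i then 1 else 0) * Var j ^ (2 * 0) :: 'n rpoly) = 1"
    by (simp add: if_distrib[of Const] sum.delta cong: if_cong)
  then show ?thesis
    using sos_exp_sum_diff[of "\<lambda>j. if j = i then 1 else 0" "\<lambda>_. 0" r] by simp
qed

text \<open>\<open>dominated_prod\<close> is applied to the factors w(\<kappa>_j) x_j^(\<kappa>_j),
  where w(k) is 2^k times the weight. Raised to the power 2^n, each is bounded by a term of
  \<open>exp_sum\<close>. The factors 2^k put into w return as the decay (1/2)^(\<kappa>_j), which
  makes the bound summable over \<kappa>.\<close>

lemma dominated_monomial:
  "\<exists>\<rho>>0. \<exists>h. \<forall>(\<kappa> :: 'n::finite \<Rightarrow> nat) c r \<eta>. 0 \<le> \<eta> \<longrightarrow> \<bar>c\<bar> \<le> \<eta> * (\<Prod>j\<in>UNIV. weight \<rho> (\<kappa> j)) \<longrightarrow>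
     (\<forall>j. h * \<kappa> j \<le> r) \<longrightarrow> 
     dominated (Const c * monomial \<kappa>) (Const (2 * \<eta> * (\<Prod>j\<in>UNIV. (1/2) ^ \<kappa> j)) * exp_sum r)"
proof -
  define n where "n = CARD('n)"
  \<comment> \<open>The power 2^n = 2h turns x_j^k into x_j^(2hk), which belongs to the term of
    index hk in \<open>exp_sum\<close>.\<close>
  define h :: nat where "h = 2 ^ (n - 1)"
  have "0 < n"
    by (simp add: n_def)
  then have h: "2 * h = 2 ^ n" "1 \<le> h"
    by (simp_all add: h_def flip: power_Suc)
  obtain B :: real where B: "1 \<le> B" "\<And>k. fact (h * k) \<le> B ^ k * fact k ^ h"
    using fact_mult_le[of h] by blast
  \<comment> \<open>Chosen so that 2\<rho> = 1/B; this cancels the geometric factor B^k of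
    \<open>fact_mult_le\<close> in \<open>w_le\<close>.\<close>
  define \<rho> where "\<rho> = 1 / (2 * B)"
  define w where "w k = 2 ^ k * weight \<rho> k" for k
  have w_nonneg: "0 \<le> w k" for k
    using B(1) by (simp add: w_def weight_def \<rho>_def)
  have w_le: "w k ^ (2 * h) \<le> 1 / fact (h * k)" for k
  proof -
    have "w k ^ (2 * h) = (w k ^ 2) ^ h"
      by (simp add: power_mult)
    also have "w k ^ 2 = (1 / B) ^ (2 * k) / fact k"
      using B(1) by (simp add: w_def weight_def \<rho>_def power_mult_distrib power_divide 
          power_mult[symmetric] mult.commute field_simps)
    also have "((1 / B) ^ (2 * k) / fact k) ^ h = (1 / B) ^ (2 * k * h) / fact k ^ h"
      by (simp add: power_divide power_mult power_mult_distrib)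
    also have "\<dots> \<le> (1 / B) ^ k / fact k ^ h"
      using B(1) h(2) by (intro divide_right_mono power_decreasing) auto
    also have "\<dots> = 1 / (B ^ k * fact k ^ h)"
      by (simp add: power_divide)
    also have "\<dots> \<le> 1 / fact (h * k)"
      using B by (intro divide_left_mono) auto
    finally show ?thesis .
  qed
  have unit: "dominated (\<Prod>j\<in>UNIV. Const (w (\<kappa> j)) * Var j ^ \<kappa> j) (Const 2 * exp_sum r)"
    if r: "\<And>j. h * \<kappa> j \<le> r" for \<kappa> :: "'n \<Rightarrow> nat" and r
  proof (rule dominated_mono[OF dominated_prod])
    have "(Const (w (\<kappa> j)) * Var j ^ \<kappa> j) ^ 2 ^ card (UNIV :: 'n set) = 
        Const (w (\<kappa> j) ^ (2 * h)) * Var j ^ (2 * (h * \<kappa> j))" for j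
      by (simp add: power_mult_distrib Const_power mult_ac flip: n_def h(1) power_mult)
    \<comment> \<open>One copy of \<open>exp_sum r\<close> pays for the constant 1, the other for
      the even powers.\<close>
    moreover have "sos ((exp_sum r - 1) + (exp_sum r - 
        (\<Sum>j\<in>UNIV. Const (w (\<kappa> j) ^ (2 * h)) * Var j ^ (2 * (h * \<kappa> j)))))"
      using r w_nonneg w_le by (intro sos_add sos_exp_sum_diff sos_exp_sum_diff_1) auto
    ultimately show "sos (Const 2 * exp_sum r -
        (1 + (\<Sum>j\<in>UNIV. (Const (w (\<kappa> j)) * Var j ^ \<kappa> j) ^ 2 ^ card (UNIV :: 'n set))))"
      by (simp add: algebra_simps flip: two_eq_Const)
  qed simp
  have "dominated (Const c * monomial \<kappa>) (Const (2 * \<eta> * (\<Prod>j\<in>UNIV. (1/2) ^ \<kappa> j)) * exp_sum r)"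
    if "0 \<le> \<eta>" "\<bar>c\<bar> \<le> \<eta> * (\<Prod>j\<in>UNIV. weight \<rho> (\<kappa> j))" "\<And>j. h * \<kappa> j \<le> r"
    for \<kappa> :: "'n \<Rightarrow> nat" and c r \<eta>
  proof -
    define W where "W = (\<Prod>j\<in>UNIV. w (\<kappa> j))"
    have wt: "0 < weight \<rho> k" for k
      using B(1) by (intro weight_pos) (simp add: \<rho>_def)
    have W: "0 < W"
      unfolding W_def w_def using wt by (intro prod_pos) auto
    have W_eq: "(\<Prod>j\<in>UNIV. weight \<rho> (\<kappa> j)) = W * (\<Prod>j\<in>UNIV. (1/2) ^ \<kappa> j)"
      unfolding W_def w_def by (simp flip: prod.distrib add: power_divide)
    have "\<bar>c\<bar> / W \<le> \<eta> * (\<Prod>j\<in>UNIV. (1/2) ^ \<kappa> j)"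
      using that(2) W unfolding W_eq by (simp add: field_simps)
    then have "dominated (Const (c / W) * (\<Prod>j\<in>UNIV. Const (w (\<kappa> j)) * Var j ^ \<kappa> j)) 
        (Const (\<eta> * (\<Prod>j\<in>UNIV. (1/2) ^ \<kappa> j)) * (Const 2 * exp_sum r))"
      using that(3) W by (intro dominated_Const_mult unit sos_Const_mult sos_exp_sum) (auto simp: abs_div)
    moreover have "Const (c / W) * (\<Prod>j\<in>UNIV. Const (w (\<kappa> j)) * Var j ^ \<kappa> j) = Const c * monomial \<kappa>"
    proof -
      have "(\<Prod>j\<in>UNIV. Const (w (\<kappa> j)) * Var j ^ \<kappa> j) = Const W * monomial \<kappa>"
        by (simp add: monomial_def prod.distrib W_def Const_prod)
      then show ?thesis
        using W by (simp flip: mult.assoc Const_mult)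
    qed
    ultimately show ?thesis
      by (simp add: Const_mult mult_ac)
  qed
  moreover have "0 < \<rho>"
    using B(1) by (simp add: \<rho>_def)
  ultimately show ?thesis
    by blast
qed

subsection \<open>Univariate polynomials in one of the variables\<close>

text \<open>The decay (1/2)^(\<kappa>_j) sums to at most 2 in each variable, so the constant does
  not depend on B; only r has to grow with the degree.\<close>

lemma dominated_sum_monomials:
  "\<exists>\<rho>>0. \<exists>h. \<forall>B (e :: ('n::finite \<Rightarrow> nat) \<Rightarrow> real) r \<eta>. 0 \<le> \<eta> \<longrightarrow> h * B \<le> r \<longrightarrow>
     (\<forall>\<kappa> \<in> PiE UNIV (\<lambda>_. {..B}). \<bar>e \<kappa>\<bar> \<le> \<eta> * (\<Prod>j\<in>UNIV. weight \<rho> (\<kappa> j))) \<longrightarrow>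
     dominated (\<Sum>\<kappa> \<in> PiE UNIV (\<lambda>_. {..B}). Const (e \<kappa>) * monomial \<kappa>)
       (Const (2 * \<eta> * 2 ^ CARD('n)) * exp_sum r)"
proof -
  obtain \<rho> h where \<rho>: "0 < \<rho>" and *: "\<And>(\<kappa> :: 'n \<Rightarrow> nat) c r \<eta>. \<lbrakk>0 \<le> \<eta>; \<bar>c\<bar> \<le> \<eta> * (\<Prod>j\<in>UNIV. weight \<rho> (\<kappa> j));
      \<And>j. h * \<kappa> j \<le> r\<rbrakk> \<Longrightarrow> 
     dominated (Const c * monomial \<kappa>) (Const (2 * \<eta> * (\<Prod>j\<in>UNIV. (1/2) ^ \<kappa> j)) * exp_sum r)"
    using dominated_monomial[where 'n = 'n] by metis
  have "dominated (\<Sum>\<kappa> \<in> PiE UNIV (\<lambda>_. {..B}). Const (e \<kappa>) * monomial \<kappa>)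
       (Const (2 * \<eta> * 2 ^ CARD('n)) * exp_sum r)"
    if \<eta>: "0 \<le> \<eta>" and r: "h * B \<le> r" 
      and e: "\<forall>\<kappa> \<in> PiE UNIV (\<lambda>_. {..B}). \<bar>e \<kappa>\<bar> \<le> \<eta> * (\<Prod>j\<in>UNIV. weight \<rho> (\<kappa> j))"
    for B r \<eta> and e :: "('n \<Rightarrow> nat) \<Rightarrow> real"
  proof (rule dominated_mono)
    let ?A = "PiE UNIV (\<lambda>_. {..B}) :: ('n \<Rightarrow> nat) set"
    let ?w = "\<lambda>\<kappa> :: 'n \<Rightarrow> nat. \<Prod>j\<in>UNIV. (1/2 :: real) ^ \<kappa> j"
    show "dominated (\<Sum>\<kappa>\<in>?A. Const (e \<kappa>) * monomial \<kappa>) (\<Sum>\<kappa>\<in>?A. Const (2 * \<eta> * ?w \<kappa>) * exp_sum r)"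
    proof (intro dominated_sum * \<eta>)
      fix \<kappa> j assume "\<kappa> \<in> ?A"
      then show "\<bar>e \<kappa>\<bar> \<le> \<eta> * (\<Prod>j\<in>UNIV. weight \<rho> (\<kappa> j))"
        using e by blast
      have "h * \<kappa> j \<le> h * B"
        using \<open>\<kappa> \<in> ?A\<close> by auto
      then show "h * \<kappa> j \<le> r"
        using r by linarith
    qed
    have "(\<Sum>\<kappa>\<in>?A. ?w \<kappa>) = (\<Prod>j\<in>(UNIV :: 'n set). \<Sum>k\<le>B. (1/2) ^ k)"
      by (subst prod_sum_PiE) auto
    also have "\<dots> \<le> (\<Prod>j\<in>(UNIV :: 'n set). 2)"
      by (intro prod_mono conjI sum_nonneg) (auto simp: sum_gp0)
    finally have "2 * \<eta> * (\<Sum>\<kappa>\<in>?A. ?w \<kappa>) \<le> 2 * \<eta> * 2 ^ CARD('n)"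
      using \<eta> by (intro mult_left_mono) auto
    then have "sos (Const (2 * \<eta> * 2 ^ CARD('n) - 2 * \<eta> * (\<Sum>\<kappa>\<in>?A. ?w \<kappa>)) * (exp_sum r :: 'n rpoly))"
      by (intro sos_Const_mult sos_exp_sum) simp
    then show "sos (Const (2 * \<eta> * 2 ^ CARD('n)) * (exp_sum r :: 'n rpoly) - (\<Sum>\<kappa>\<in>?A. Const (2 * \<eta> * ?w \<kappa>) * exp_sum r))"
      by (simp only: Const_diff left_diff_distrib Const_sum sum_distrib_left sum_distrib_right)
  qed
  then show ?thesis
    using \<rho> by blast
qed

section \<open>Substitution of a variable into univariate polynomials\<close>

definition univ :: "'n \<Rightarrow> real poly \<Rightarrow> 'n rpoly" where
  "univ j g = poly (map_poly Const g) (Var j)"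

lemma univ_0 [simp]: "univ j 0 = 0"
  by (simp add: univ_def)

lemma univ_pCons: "univ j (pCons a g) = Const a + Var j * univ j g"
  by (simp add: univ_def map_poly_pCons)

lemma univ_1 [simp]: "univ j 1 = 1"
  by (simp add: one_pCons univ_pCons)

lemma univ_add: "univ j (g + h) = univ j g + univ j h"
  by (induction g h rule: poly_induct2) (simp_all add: univ_pCons Const_add algebra_simps)

lemma univ_2: "univ j 2 = 2"
  using univ_add[of j 1 1] by simp

lemma univ_smult: "univ j (smult a g) = Const a * univ j g"
  by (induction g) (simp_all add: univ_pCons Const_mult algebra_simps)

lemma univ_mult: "univ j (g * h) = univ j g * univ j h"
  by (induction g) (simp_all add: univ_pCons univ_add univ_smult algebra_simps)

lemma univ_power: "univ j (g ^ k) = univ j g ^ k"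
  by (induction k) (simp_all add: univ_mult)

lemma univ_monom: "univ j (monom 1 k) = Var j ^ k"
  by (induction k) (simp_all add: monom_Suc univ_pCons monom_0)

text \<open>An arbitrary degree bound as summation range lets all factors of a product over the
  variables share one index set.\<close>

lemma univ_eq_sum:
  assumes "degree g \<le> B"
  shows "univ j g = (\<Sum>k\<le>B. Const (coeff g k) * Var j ^ k)"
proof -
  have "univ j g = (\<Sum>k\<le>degree (map_poly Const g :: 'a rpoly poly). Const (coeff g k) * Var j ^ k)"
    by (simp add: univ_def poly_altdef coeff_map_poly)
  also have "\<dots> = (\<Sum>k\<le>B. Const (coeff g k) * Var j ^ k)"
  proof (intro sum.mono_neutral_left)
    have "degree (map_poly Const g :: 'a rpoly poly) \<le> degree g"
      by (rule map_poly_degree_leq)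
    then show "{..degree (map_poly Const g :: 'a rpoly poly)} \<subseteq> {..B}"
      using assms by auto
    have "Const (coeff g k) = (0 :: 'a rpoly)" if "degree (map_poly Const g :: 'a rpoly poly) < k" for k
      using coeff_eq_0[OF that] by (simp add: coeff_map_poly)
    then show "\<forall>i\<in>{..B} - {..degree (map_poly Const g :: 'a rpoly poly)}. 
        Const (coeff g i) * Var j ^ i = (0 :: 'a rpoly)"
      by simp
  qed simp
  finally show ?thesis .
qed

lemma prod_univ_eq_sum:
  fixes g :: "'n::finite \<Rightarrow> real poly"
  assumes "\<And>j. degree (g j) \<le> B"
  shows "(\<Prod>j\<in>UNIV. univ j (g j)) = 
    (\<Sum>\<kappa> \<in> PiE UNIV (\<lambda>_. {..B}). Const (\<Prod>j\<in>UNIV. coeff (g j) (\<kappa> j)) * monomial \<kappa>)"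
  using assms
  by (simp add: univ_eq_sum[of _ B] prod_sum_PiE prod.distrib Const_prod monomial_def)

text \<open>Telescoping: a_i A - b_i B = a_i (A - B) + (a_i - b_i) B. With \<open>v\<close> a weight
  this compares coefficients of products over the variables; with \<open>v\<close> = 1 it compares
  Bernstein coefficients with values of monomials.\<close>

lemma abs_prod_diff_le:
  fixes a b v :: "'a \<Rightarrow> real"
  assumes "finite A" "0 \<le> \<eta>" "0 \<le> C"
    and "\<And>j. j \<in> A \<Longrightarrow> 0 \<le> v j" "\<And>j. j \<in> A \<Longrightarrow> \<bar>a j - b j\<bar> \<le> \<eta> * v j" 
    and "\<And>j. j \<in> A \<Longrightarrow> \<bar>b j\<bar> \<le> C * v j"
  shows "\<bar>prod a A - prod b A\<bar> \<le> ((C + \<eta>) ^ card A - C ^ card A) * prod v A"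
  using assms(1,4-)
proof (induction A rule: finite_induct)
  case empty
  then show ?case by simp
next
  case (insert i A)
  let ?n = "card A"
  have 1: "\<bar>prod a A - prod b A\<bar> \<le> ((C + \<eta>) ^ ?n - C ^ ?n) * prod v A"
    using insert by auto
  have 2: "\<bar>prod b A\<bar> \<le> C ^ ?n * prod v A"
  proof -
    have "\<bar>prod b A\<bar> \<le> (\<Prod>j\<in>A. C * v j)"
      unfolding abs_prod by (intro prod_mono) (use insert in auto)
    then show ?thesis
      by (simp add: prod.distrib)
  qed
  have 3: "\<bar>a i\<bar> \<le> (C + \<eta>) * v i"
    using insert.prems(2)[of i] insert.prems(3)[of i] by (simp add: algebra_simps)
  have "\<bar>prod a (insert i A) - prod b (insert i A)\<bar> = 
      \<bar>a i * (prod a A - prod b A) + (a i - b i) * prod b A\<bar>"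
    using insert.hyps by (simp add: algebra_simps)
  also have "\<dots> \<le> \<bar>a i\<bar> * \<bar>prod a A - prod b A\<bar> + \<bar>a i - b i\<bar> * \<bar>prod b A\<bar>"
    by (metis abs_mult abs_triangle_ineq)
  also have "\<dots> \<le> ((C + \<eta>) * v i) * (((C + \<eta>) ^ ?n - C ^ ?n) * prod v A) + 
      (\<eta> * v i) * (C ^ ?n * prod v A)"
    using assms(2,3) insert.prems by (intro add_mono mult_mono 1 2 3) auto
  also have "\<dots> = ((C + \<eta>) ^ card (insert i A) - C ^ card (insert i A)) * prod v (insert i A)"
    using insert.hyps by (simp add: algebra_simps)
  finally show ?case .
qed

section \<open>Coefficientwise bounds on the scale of the weights\<close>

definition majorized :: "real \<Rightarrow> real \<Rightarrow> real poly \<Rightarrow> bool" where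
  "majorized C \<rho> g \<longleftrightarrow> (\<forall>k. \<bar>coeff g k\<bar> \<le> C * weight \<rho> k)"

lemma majorized_add: "majorized C \<rho> g \<Longrightarrow> majorized D \<rho> h \<Longrightarrow> majorized (C + D) \<rho> (g + h)"
  unfolding majorized_def by (smt (verit) coeff_add distrib_right)

lemma majorized_mono:
  assumes "majorized C \<rho> g" "C \<le> D" "0 \<le> C" "\<rho> \<le> \<sigma>" "0 < \<rho>"
  shows "majorized D \<sigma> g"
  unfolding majorized_def
proof
  fix k
  have "\<bar>coeff g k\<bar> \<le> C * weight \<rho> k"
    using assms(1) by (simp add: majorized_def)
  also have "\<dots> \<le> D * weight \<sigma> k"
    using assms by (intro mult_mono) (auto simp: weight_def intro!: divide_right_mono power_mono)
  finally show "\<bar>coeff g k\<bar> \<le> D * weight \<sigma> k" .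
qed

text \<open>The left side equals sqrt(binom(k, i)) times \<open>weight \<rho> k\<close>; replacing
  the root by the full binomial makes the later sum over i computable.\<close>

lemma weight_mult_le:
  assumes "0 < \<rho>" "i \<le> k"
  shows "weight \<rho> i * weight \<rho> (k - i) \<le> real (k choose i) * weight \<rho> k"
proof -
  have "fact k = fact i * fact (k - i) * real (k choose i)"
    using binomial_fact_lemma[OF assms(2), THEN arg_cong[where f = real]] by simp
  then have *: "sqrt (fact k) = sqrt (fact i) * sqrt (fact (k - i)) * sqrt (real (k choose i))"
    by (simp add: real_sqrt_mult)
  have pos: "0 < real (k choose i)"
    using assms(2) by simp
  have "weight \<rho> i * weight \<rho> (k - i) = \<rho> ^ k / (sqrt (fact i) * sqrt (fact (k - i)))"
    using assms(2) by (simp add: weight_def flip: power_add)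
  also have "\<dots> = sqrt (real (k choose i)) * weight \<rho> k"
    using pos by (simp add: weight_def *)
  also have "\<dots> \<le> real (k choose i) * weight \<rho> k"
  proof (intro mult_right_mono)
    have "1 \<le> real (k choose i)"
      using pos by (simp add: Suc_le_eq)
    then show "sqrt (real (k choose i)) \<le> real (k choose i)"
      by (intro real_le_lsqrt self_le_power) auto
    show "0 \<le> weight \<rho> k"
      using weight_pos[OF assms(1)] by (rule less_imp_le)
  qed
  finally show ?thesis .
qed

text \<open>The binomials from \<open>weight_mult_le\<close> add up to 2^k, which is absorbed by
  doubling \<rho>.\<close>

lemma majorized_mult:
  assumes "majorized C \<rho> g" "majorized D \<rho> h" "0 < \<rho>" "0 \<le> C" "0 \<le> D"
  shows "majorized (C * D) (2 * \<rho>) (g * h)"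
  unfolding majorized_def
proof
  fix k
  have w: "0 < weight \<rho> i" for i
    using assms(3) by (rule weight_pos)
  have "\<bar>coeff (g * h) k\<bar> \<le> (\<Sum>i\<le>k. \<bar>coeff g i\<bar> * \<bar>coeff h (k - i)\<bar>)"
    unfolding coeff_mult by (rule order_trans[OF sum_abs]) (simp add: abs_mult)
  also have "\<dots> \<le> (\<Sum>i\<le>k. C * D * (real (k choose i) * weight \<rho> k))"
  proof (intro sum_mono)
    fix i assume "i \<in> {..k}"
    have "\<bar>coeff g i\<bar> * \<bar>coeff h (k - i)\<bar> \<le> (C * weight \<rho> i) * (D * weight \<rho> (k - i))"
      using assms w by (intro mult_mono) (auto simp: majorized_def less_imp_le)
    also have "\<dots> = C * D * (weight \<rho> i * weight \<rho> (k - i))"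
      by simp
    also have "\<dots> \<le> C * D * (real (k choose i) * weight \<rho> k)"
      using assms \<open>i \<in> {..k}\<close> by (intro mult_left_mono weight_mult_le) auto
    finally show "\<bar>coeff g i\<bar> * \<bar>coeff h (k - i)\<bar> \<le> C * D * (real (k choose i) * weight \<rho> k)" .
  qed
  also have "\<dots> = C * D * weight \<rho> k * real (\<Sum>i\<le>k. k choose i)"
    by (simp add: sum_distrib_left mult_ac)
  also have "\<dots> = C * D * weight (2 * \<rho>) k"
    by (simp only: choose_row_sum) (simp add: weight_def power_mult_distrib)
  finally show "\<bar>coeff (g * h) k\<bar> \<le> C * D * weight (2 * \<rho>) k" .
qed

lemma majorized_X: "0 < \<rho> \<Longrightarrow> majorized (1 / \<rho>) \<rho> [:0, 1:]"
  by (auto simp: majorized_def coeff_pCons weight_def split: nat.split)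

lemma majorized_monom: "0 < \<rho> \<Longrightarrow> majorized (1 / weight \<rho> b) \<rho> (monom 1 b)"
  using weight_pos[of \<rho>] by (auto simp: majorized_def less_imp_le less_imp_neq[symmetric])

text \<open>Continuity of (X + e)^b (1 + v) at e = v = 0 in the sense of \<open>majorized\<close>.
  If G is the error at b, the error at b + 1 is (X + e) G + e X^b. A product doubles \<rho>, so the
  induction hypothesis is used at \<rho>/2.\<close>

lemma majorized_power_perturbed:
  assumes "0 < \<rho>" "0 < \<eta>"
  shows "\<exists>\<epsilon>>0. \<exists>\<sigma>>0. \<forall>e v. majorized \<epsilon> \<sigma> e \<longrightarrow> majorized \<epsilon> \<sigma> v \<longrightarrow> majorized \<eta> \<rho> (([:0, 1:] + e) ^ b * (1 + v) - monom 1 b)"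
  using assms
proof (induction b arbitrary: \<rho> \<eta>)
  case 0
  then show ?case
    by (auto simp: monom_0 one_pCons[symmetric] intro: exI[of _ \<eta>] exI[of _ \<rho>])
next
  case (Suc b)
  define \<tau> where "\<tau> = \<rho> / 2"
  \<comment> \<open>X + e has bound 1/\<tau> + 1 and X^b has bound W, so \<zeta> and \<epsilon>'
    give each of the two error terms at most half of \<eta>.\<close>
  define \<zeta> where "\<zeta> = \<eta> / (2 * (1 / \<tau> + 1))"
  define W where "W = 1 / weight \<tau> b"
  have \<tau>: "0 < \<tau>" "\<rho> = 2 * \<tau>"
    using Suc.prems by (simp_all add: \<tau>_def)
  have \<zeta>: "0 < \<zeta>" "(1 / \<tau> + 1) * \<zeta> = \<eta> / 2"
    using Suc.prems \<tau> by (simp_all add: \<zeta>_def divide_simps add_pos_pos)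
  have W: "0 < W"
    using weight_pos[OF \<tau>(1)] by (simp add: W_def)
  obtain \<epsilon> \<sigma> where es: "0 < \<epsilon>" "0 < \<sigma>" 
    and IH: "\<And>e v. majorized \<epsilon> \<sigma> e \<Longrightarrow> majorized \<epsilon> \<sigma> v \<Longrightarrow> majorized \<zeta> \<tau> (([:0, 1:] + e) ^ b * (1 + v) - monom 1 b)"
    using Suc.IH[OF \<tau>(1) \<zeta>(1)] by blast
  define \<epsilon>' where "\<epsilon>' = min \<epsilon> (min 1 (\<eta> / (2 * W)))"
  define \<sigma>' where "\<sigma>' = min \<sigma> \<tau>"
  have \<epsilon>': "0 < \<epsilon>'" "\<epsilon>' \<le> \<epsilon>" "\<epsilon>' \<le> 1" "\<epsilon>' * W \<le> \<eta> / 2"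
  proof -
    have "\<epsilon>' \<le> \<eta> / (2 * W)"
      by (simp add: \<epsilon>'_def)
    then show "\<epsilon>' * W \<le> \<eta> / 2"
      using W by (simp add: field_simps)
  qed (use es W Suc.prems in \<open>auto simp: \<epsilon>'_def\<close>)
  have \<sigma>': "0 < \<sigma>'" "\<sigma>' \<le> \<sigma>" "\<sigma>' \<le> \<tau>"
    using es \<tau> by (auto simp: \<sigma>'_def)
  have "majorized \<eta> \<rho> (([:0, 1:] + e) ^ Suc b * (1 + v) - monom 1 (Suc b))"
    if ev: "majorized \<epsilon>' \<sigma>' e" "majorized \<epsilon>' \<sigma>' v" for e v
  proof -
    define G where "G = ([:0, 1:] + e) ^ b * (1 + v) - monom 1 b"
    have G: "majorized \<zeta> \<tau> G"
      unfolding G_def using ev \<epsilon>' \<sigma>' by (intro IH) (auto intro: majorized_mono)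
    have e1: "majorized 1 \<tau> e"
      using \<epsilon>' \<sigma>' by (intro majorized_mono[OF ev(1)]) auto
    have e2: "majorized \<epsilon>' \<tau> e"
      using \<epsilon>' \<sigma>' by (intro majorized_mono[OF ev(1)]) auto
    have "majorized ((1 / \<tau> + 1) * \<zeta>) (2 * \<tau>) (([:0, 1:] + e) * G)"
      using \<tau> \<zeta> by (intro majorized_mult majorized_add majorized_X e1 G) auto
    moreover have "majorized (\<epsilon>' * W) (2 * \<tau>) (e * monom 1 b)"
      unfolding W_def using \<tau> \<epsilon>' weight_pos[OF \<tau>(1), of b] 
      by (intro majorized_mult majorized_monom e2) (auto simp: less_imp_le)
    ultimately have "majorized ((1 / \<tau> + 1) * \<zeta> + \<epsilon>' * W) (2 * \<tau>) (([:0, 1:] + e) * G + e * monom 1 b)"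
      by (rule majorized_add)
    moreover have "([:0, 1:] + e) ^ Suc b * (1 + v) - monom 1 (Suc b) = ([:0, 1:] + e) * G + e * monom 1 b"
      by (simp add: G_def monom_Suc algebra_simps)
    ultimately have *: "majorized ((1 / \<tau> + 1) * \<zeta> + \<epsilon>' * W) (2 * \<tau>) (([:0, 1:] + e) ^ Suc b * (1 + v) - monom 1 (Suc b))"
      by simp
    have "0 \<le> (1 / \<tau> + 1) * \<zeta> + \<epsilon>' * W" "(1 / \<tau> + 1) * \<zeta> + \<epsilon>' * W \<le> \<eta>"
      unfolding \<zeta>(2) using \<epsilon>' Suc.prems W by (simp_all add: less_imp_le)
    then show ?thesis
      using * \<tau> by (auto intro: majorized_mono)
  qed
  then show ?case
    using \<epsilon>'(1) \<sigma>'(1) by blast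
qed

subsection \<open>Polynomial approximations of sine and cosine\<close>

text \<open>Real and imaginary part of (1 + i t x)^m; one step multiplies by 1 + i t x. For m = 2M
  and t = 1/(2RM) they approximate cosine and sine of x/R.\<close>

fun cos_poly sin_poly :: "real \<Rightarrow> nat \<Rightarrow> real poly" where
  "cos_poly t 0 = 1"
| "sin_poly t 0 = 0"
| "cos_poly t (Suc m) = cos_poly t m - [:0, t:] * sin_poly t m"
| "sin_poly t (Suc m) = sin_poly t m + [:0, t:] * cos_poly t m"

text \<open>Multiplicativity of the squared modulus of 1 + i t x; this replaces the relation cos^2 +
  sin^2 = 1.\<close>

lemma cos_sin_poly_squares: "cos_poly t m ^ 2 + sin_poly t m ^ 2 = (1 + [:0, t:] ^ 2) ^ m"
proof (induction m)
  case 0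
  then show ?case by simp
next
  case (Suc m)
  let ?x = "[:0, t:]" and ?c = "cos_poly t m" and ?s = "sin_poly t m"
  have "cos_poly t (Suc m) ^ 2 + sin_poly t (Suc m) ^ 2 = 
      (?c - ?x * ?s) ^ 2 + (?s + ?x * ?c) ^ 2"
    by (simp only: cos_poly.simps sin_poly.simps)
  also have "\<dots> = (1 + ?x ^ 2) * (?c ^ 2 + ?s ^ 2)"
    by algebra
  finally show ?case
    unfolding Suc by (simp only: power_Suc)
qed

text \<open>The addition theorems, from z^(m+k) = z^m z^k with z = 1 + i t x; they yield the double
  angle formula.\<close>

lemma cos_sin_poly_add:
  "cos_poly t (m + k) = cos_poly t m * cos_poly t k - sin_poly t m * sin_poly t k \<and>
   sin_poly t (m + k) = sin_poly t m * cos_poly t k + cos_poly t m * sin_poly t k"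
  (is "?P m")
proof (induction m)
  case 0
  then show ?case by simp
next
  case (Suc m)
  let ?x = "[:0, t:]" and ?c = "cos_poly t m" and ?s = "sin_poly t m" 
    and ?d = "cos_poly t k" and ?u = "sin_poly t k"
  have c: "cos_poly t (m + k) = ?c * ?d - ?s * ?u" and s: "sin_poly t (m + k) = ?s * ?d + ?c * ?u"
    using Suc by auto
  have "(?c * ?d - ?s * ?u) - ?x * (?s * ?d + ?c * ?u) = (?c - ?x * ?s) * ?d - (?s + ?x * ?c) * ?u"
    "(?s * ?d + ?c * ?u) + ?x * (?c * ?d - ?s * ?u) = (?s + ?x * ?c) * ?d + (?c - ?x * ?s) * ?u"
    by algebra+
  then show ?case
    by (simp only: add_Suc cos_poly.simps sin_poly.simps c s)
qed

lemma sin_poly_double: "sin_poly t (2 * m) = 2 * cos_poly t m * sin_poly t m"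
proof -
  have "sin_poly t (2 * m) = sin_poly t m * cos_poly t m + cos_poly t m * sin_poly t m"
    using cos_sin_poly_add[of t m m] unfolding mult_2 by blast
  then show ?thesis
    by (simp add: algebra_simps)
qed

text \<open>Up to signs and omitted terms, both are the expansion of (1 + t x)^m; the induction step
  is Pascal's rule.\<close>

lemma abs_coeff_cos_sin_poly_le:
  assumes "0 \<le> t"
  shows "\<bar>coeff (cos_poly t m) k\<bar> \<le> real (m choose k) * t ^ k \<and>
         \<bar>coeff (sin_poly t m) k\<bar> \<le> real (m choose k) * t ^ k"
proof (induction m arbitrary: k)
  case 0
  then show ?case
    by (cases k) auto
next
  case (Suc m)
  show ?case
  proof (cases k)
    case 0
    then show ?thesis
      using Suc[of 0] by simp
  next
    case (Suc k')
    have step: "\<bar>a\<bar> + \<bar>t * b\<bar> \<le> real (Suc m choose k) * t ^ k" 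
      if "\<bar>a\<bar> \<le> real (m choose k) * t ^ k" "\<bar>b\<bar> \<le> real (m choose k') * t ^ k'" for a b :: real
    proof -
      have "\<bar>t * b\<bar> \<le> t * (real (m choose k') * t ^ k')"
        using that(2) assms by (simp add: abs_mult mult_left_mono)
      then show ?thesis
        using that(1) Suc by (simp add: algebra_simps)
    qed
    have "\<bar>coeff (cos_poly t (Suc m)) k\<bar> \<le> \<bar>coeff (cos_poly t m) k\<bar> + \<bar>t * coeff (sin_poly t m) k'\<bar>"
      "\<bar>coeff (sin_poly t (Suc m)) k\<bar> \<le> \<bar>coeff (sin_poly t m) k\<bar> + \<bar>t * coeff (cos_poly t m) k'\<bar>"
      using Suc by auto
    then show ?thesis
      using step[of "coeff (cos_poly t m) k" "coeff (sin_poly t m) k'"] 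
        step[of "coeff (sin_poly t m) k" "coeff (cos_poly t m) k'"] Suc.IH[of k] Suc.IH[of k']
      by linarith
  qed
qed

lemma coeff_cos_sin_poly_low:
  "coeff (cos_poly t m) 0 = 1" "coeff (sin_poly t m) 0 = 0" "coeff (sin_poly t m) (Suc 0) = real m * t"
  by (induction m) (simp_all add: algebra_simps)

lemma weight_ge_fact: "0 < \<rho> \<Longrightarrow> \<rho> ^ k / fact k \<le> weight \<rho> k"
  unfolding weight_def
proof (intro divide_left_mono)
  have "1 \<le> (fact k :: real)" by simp
  then show "sqrt (fact k) \<le> (fact k :: real)"
    by (intro real_le_lsqrt self_le_power) auto
qed auto

text \<open>Two of the k factors are spent on a smallness factor, which tends to 0 for x = 1/R and
  large R.\<close>

lemma power_le_of_ge_2: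
  fixes x y :: real
  assumes "0 \<le> x" "x \<le> y" "0 < y" "2 \<le> k"
  shows "x ^ k \<le> (x / y) ^ 2 * y ^ k"
proof -
  have "(x / y) ^ k \<le> (x / y) ^ 2"
    using assms by (intro power_decreasing) auto
  then have "(x / y) ^ k * y ^ k \<le> (x / y) ^ 2 * y ^ k"
    using assms by (intro mult_right_mono) auto
  then show ?thesis
    using assms by (simp add: power_divide)
qed

text \<open>The scaled sine agrees with x in degrees 0 and 1. For k \<ge> 2 its coefficient is at
  most R (1/R)^k / k!, because binom(2M, k) \<le> (2M)^k / k! and 2Mt = 1/R; the factor R^(-2)
  available for k \<ge> 2 beats R. The bound is uniform in M.\<close>

lemma majorized_sin_poly:
  assumes "1 \<le> M" "0 < \<rho>" "1 / \<rho> \<le> R"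
  shows "majorized (1 / (R * \<rho> ^ 2)) \<rho> (smult R (sin_poly (1 / (2 * R * real M)) (2 * M)) - [:0, 1:])"
  unfolding majorized_def
proof
  fix k
  define t where "t = 1 / (2 * R * real M)"
  have R: "0 < R"
    using assms by (smt (verit) divide_pos_pos)
  have t: "0 < t" "R * (2 * real M * t) = 1"
    using R assms(1) by (simp_all add: t_def)
  have w: "0 < weight \<rho> k"
    using assms(2) by (rule weight_pos)
  consider "k = 0" | "k = 1" | "2 \<le> k"
    by linarith
  then show "\<bar>coeff (smult R (sin_poly (1 / (2 * R * real M)) (2 * M)) - [:0, 1:]) k\<bar> 
     \<le> 1 / (R * \<rho> ^ 2) * weight \<rho> k"
  proof cases
    case 3
    have "coeff [:0, 1::real:] k = 0"
      using 3 by (intro coeff_eq_0) auto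
    then have "\<bar>coeff (smult R (sin_poly t (2 * M)) - [:0, 1:]) k\<bar> = R * \<bar>coeff (sin_poly t (2 * M)) k\<bar>"
      using R by (simp add: abs_mult)
    also have "\<dots> \<le> R * (real (2 * M choose k) * t ^ k)"
      using abs_coeff_cos_sin_poly_le[of t] t R by (intro mult_left_mono) auto
    also have "\<dots> \<le> R * ((2 * real M) ^ k / fact k * t ^ k)"
    proof -
      have "real (2 * M choose k) * fact k \<le> (2 * real M) ^ k"
        using of_nat_mono[OF binomial_fact_pow[of "2 * M" k], where 'a = real] by simp
      then show ?thesis
        using R t by (intro mult_left_mono mult_right_mono) (auto simp: field_simps)
    qed
    also have "\<dots> = R * ((1 / R) ^ k / fact k)"
    proof -
      have "2 * real M * t = 1 / R"
        using t(2) R by (simp add: field_simps)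
      then have "(2 * real M) ^ k * t ^ k = (1 / R) ^ k"
        by (simp only: power_mult_distrib[symmetric])
      then show ?thesis
        by (simp only: times_divide_eq_left)
    qed
    also have "\<dots> \<le> R * ((1 / R / \<rho>) ^ 2 * \<rho> ^ k / fact k)"
      using R assms(2,3) 3 by (intro mult_left_mono divide_right_mono power_le_of_ge_2) (auto simp: field_simps)
    also have "\<dots> = 1 / (R * \<rho> ^ 2) * (\<rho> ^ k / fact k)"
      using R by (simp add: power2_eq_square)
    also have "\<dots> \<le> 1 / (R * \<rho> ^ 2) * weight \<rho> k"
      using R assms(2) by (intro mult_left_mono weight_ge_fact) auto
    finally show ?thesis
      by (simp only: t_def)
  qed (use R w assms(1) in \<open>simp_all add: coeff_cos_sin_poly_low\<close>)
qed

lemma coeff_one_plus_square_power: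
  "coeff ((1 + [:0, t:] ^ 2) ^ L) k = (if even k then real (L choose (k div 2)) * t ^ k else 0)"
proof -
  have "(1 + [:0, t:] ^ 2) ^ L = (\<Sum>i\<le>L. of_nat (L choose i) * ([:0, t:] ^ 2) ^ i)"
    by (subst add.commute) (simp add: binomial_ring)
  also have "\<dots> = (\<Sum>i\<le>L. monom (real (L choose i) * t ^ (2 * i)) (2 * i))"
  proof (intro sum.cong refl)
    fix i
    have "[:0, t:] = monom t 1"
      by (simp add: monom_Suc monom_0)
    then show "of_nat (L choose i) * ([:0, t:] ^ 2) ^ i = monom (real (L choose i) * t ^ (2 * i)) (2 * i)"
      by (simp add: monom_power of_nat_monom mult_monom flip: power_mult)
  qed
  finally have "coeff ((1 + [:0, t:] ^ 2) ^ L) k = 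
     (\<Sum>i\<le>L. if 2 * i = k then real (L choose i) * t ^ (2 * i) else 0)"
    by (simp add: coeff_sum)
  also have "\<dots> = (if even k then real (L choose (k div 2)) * t ^ k else 0)"
  proof (cases "even k")
    case True
    then obtain i where k: "k = 2 * i" by blast
    then show ?thesis
      by (simp add: sum.delta)
  next
    case False
    then show ?thesis
      by (auto intro!: sum.neutral)
  qed
  finally show ?thesis .
qed

text \<open>For N \<le> M the coefficients are at most those of exp((x/(2R))^2), namely (1/(2R))^k /
  (k/2)! for even k. Up to a geometric factor this is the decay 1/sqrt(k!) that
  \<open>weight\<close> allows.\<close>

lemma majorized_one_plus_square_power:
  assumes "1 \<le> M" "N \<le> M" "0 < \<rho>" "1 / \<rho> \<le> R"
  shows "majorized (1 / (R * \<rho>) ^ 2) \<rho> ((1 + [:0, 1 / (2 * R * real M):] ^ 2) ^ (M * N) - 1)"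
  unfolding majorized_def
proof
  fix k
  define t where "t = 1 / (2 * R * real M)"
  have R: "0 < R"
    using assms by (smt (verit) divide_pos_pos)
  have t: "0 < t"
    using R assms(1) by (simp add: t_def)
  have w: "0 < weight \<rho> k"
    using assms(3) by (rule weight_pos)
  show "\<bar>coeff ((1 + [:0, 1 / (2 * R * real M):] ^ 2) ^ (M * N) - 1) k\<bar> \<le> 1 / (R * \<rho>) ^ 2 * weight \<rho> k"
  proof (cases "k = 0 \<or> odd k")
    case True
    then show ?thesis
      using w by (auto simp: coeff_one_plus_square_power)
  next
    case False
    then obtain i where k: "k = 2 * i" "0 < i"
      by auto
    have "coeff (1 :: real poly) k = 0"
      using k by simp
    then have "\<bar>coeff ((1 + [:0, t:] ^ 2) ^ (M * N) - 1) k\<bar> = real (M * N choose i) * t ^ k"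
      using k t by (simp add: coeff_one_plus_square_power del: power_mult)
    also have "\<dots> \<le> (real (M * M)) ^ i / fact i * t ^ k"
    proof (intro mult_right_mono)
      have "real (M * N choose i) * fact i \<le> real (M * N) ^ i"
        using of_nat_mono[OF binomial_fact_pow[of "M * N" i], where 'a = real] by simp
      also have "\<dots> \<le> real (M * M) ^ i"
        using assms(2) by (intro power_mono) (auto intro: mult_left_mono)
      finally show "real (M * N choose i) \<le> real (M * M) ^ i / fact i"
        by (simp add: field_simps)
    qed (use t in simp)
    also have "\<dots> = (1 / (2 * R)) ^ k / fact i"
    proof -
      have "real (M * M) ^ i = real M ^ k"
        by (simp add: k power_mult power2_eq_square)
      moreover have "real M * t = 1 / (2 * R)"
        using assms(1) by (simp add: t_def)
      ultimately have "real (M * M) ^ i * t ^ k = (1 / (2 * R)) ^ k"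
        by (simp only: power_mult_distrib[symmetric])
      then show ?thesis
        by (simp only: times_divide_eq_left)
    qed
    \<comment> \<open>The central binomial coefficient gives (2i)! \<le> (i! 2^i)^2, which trades
      1/i! for 2^k / sqrt(k!); the 2^k then cancels against (1/(2R))^k.\<close>
    also have "\<dots> \<le> (1 / (2 * R)) ^ k * (2 ^ k / sqrt (fact k))"
    proof -
      have "real (2 * i choose i) \<le> 2 ^ (2 * i)"
        using of_nat_mono[OF binomial_le_pow2[of "2 * i" i], where 'a = real] by simp
      moreover have "fact (2 * i) = fact i * fact i * real (2 * i choose i)"
        using binomial_fact_lemma[of i "2 * i", THEN arg_cong[where f = real]] by simp
      ultimately have "fact (2 * i) \<le> fact i * fact i * (2 :: real) ^ (2 * i)"
        by simp
      then have "fact k \<le> (fact i * 2 ^ i :: real) ^ 2"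
        by (simp add: k power2_eq_square mult_2 mult_2_right power_add mult_ac)
      then have "sqrt (fact k) \<le> fact i * 2 ^ i"
        by (intro real_le_lsqrt) auto
      also have "\<dots> \<le> fact i * 2 ^ k"
        by (intro mult_left_mono power_increasing) (auto simp: k)
      finally have "1 / fact i \<le> 2 ^ k / sqrt (fact k)"
        by (simp add: field_simps)
      then have "(1 / (2 * R)) ^ k * (1 / fact i) \<le> (1 / (2 * R)) ^ k * (2 ^ k / sqrt (fact k))"
        using R by (intro mult_left_mono) auto
      then show ?thesis
        by simp
    qed
    also have "\<dots> = (1 / R) ^ k / sqrt (fact k)"
      by (simp add: power_divide power_mult_distrib)
    also have "\<dots> \<le> (1 / R / \<rho>) ^ 2 * \<rho> ^ k / sqrt (fact k)"
      using R assms(3,4) k by (intro divide_right_mono power_le_of_ge_2) (auto simp: field_simps)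
    also have "\<dots> = 1 / (R * \<rho>) ^ 2 * weight \<rho> k"
      by (simp add: weight_def power_divide power_mult_distrib)
    finally show ?thesis
      by (simp add: t_def)
  qed
qed

text \<open>R is fixed before the Bernstein degree, so closeness to x^b is needed for all M and N at
  once. With e the error of the sine and 1 + v the homogenizing factor, this is an instance of
  \<open>majorized_power_perturbed\<close>.\<close>

lemma eventually_majorized_power:
  assumes "0 < \<rho>" "0 < \<eta>"
  shows "\<forall>\<^sub>F R in at_top. \<forall>M N. 1 \<le> M \<longrightarrow> N \<le> M \<longrightarrow> 
    majorized \<eta> \<rho> (smult R (sin_poly (1 / (2 * R * real M)) (2 * M)) ^ b * 
      ((1 + [:0, 1 / (2 * R * real M):] ^ 2) ^ M) ^ N - monom 1 b)"
proof -
  obtain \<epsilon> \<sigma> where es: "0 < \<epsilon>" "0 < \<sigma>" 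
    and *: "\<And>e v. majorized \<epsilon> \<sigma> e \<Longrightarrow> majorized \<epsilon> \<sigma> v \<Longrightarrow> majorized \<eta> \<rho> (([:0, 1:] + e) ^ b * (1 + v) - monom 1 b)"
    using majorized_power_perturbed[OF assms] by blast
  \<comment> \<open>The first threshold makes the two majorization lemmas applicable, the second
    gives \<open>R1\<close>, and the third together with the first gives \<open>R2\<close>.\<close>
  have "\<forall>\<^sub>F R in at_top. max (1 / \<sigma>) (max (1 / (\<epsilon> * \<sigma> ^ 2)) (1 / (\<epsilon> * \<sigma>))) \<le> R"
    by (rule eventually_ge_at_top)
  then show ?thesis
  proof eventually_elim
    case (elim R)
    have R: "0 < R" "1 / \<sigma> \<le> R"
      using elim es by (auto intro: less_le_trans[of 0 "1 / \<sigma>"])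
    have R1: "1 / (R * \<sigma> ^ 2) \<le> \<epsilon>"
      using elim es R by (simp add: field_simps)
    have R2: "1 / (R * \<sigma>) ^ 2 \<le> \<epsilon>"
    proof -
      have "1 \<le> R * \<sigma>" "1 \<le> \<epsilon> * (R * \<sigma>)"
        using elim es R by (auto simp: field_simps)
      then have "1 * 1 \<le> (\<epsilon> * (R * \<sigma>)) * (R * \<sigma>)"
        by (intro mult_mono) auto
      then show ?thesis
        using R es by (simp add: field_simps power2_eq_square)
    qed
    show ?case
    proof (intro allI impI)
      fix M N :: nat assume MN: "1 \<le> M" "N \<le> M"
      define e where "e = smult R (sin_poly (1 / (2 * R * real M)) (2 * M)) - [:0, 1:]"
      define v where "v = (1 + [:0, 1 / (2 * R * real M):] ^ 2) ^ (M * N) - 1"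
      have "majorized \<epsilon> \<sigma> e"
        using majorized_mono[OF majorized_sin_poly[OF MN(1) es(2) R(2)] R1, of \<sigma>] R es by (simp add: e_def)
      moreover have "majorized \<epsilon> \<sigma> v"
        using majorized_mono[OF majorized_one_plus_square_power[OF MN es(2) R(2)] R2, of \<sigma>] es by (simp add: v_def)
      ultimately have "majorized \<eta> \<rho> (([:0, 1:] + e) ^ b * (1 + v) - monom 1 b)"
        by (rule *)
      then show "majorized \<eta> \<rho> (smult R (sin_poly (1 / (2 * R * real M)) (2 * M)) ^ b * 
         ((1 + [:0, 1 / (2 * R * real M):] ^ 2) ^ M) ^ N - monom 1 b)"
        by (simp only: e_def v_def add_diff_cancel_left' add_diff_eq diff_add_cancel power_mult add.commute)
    qed
  qed
qed

subsection \<open>Bernstein expansions\<close>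

text \<open>For b \<le> N this is the coefficient of p^i m^(N-i) in (p - m)^b (p + m)^(N-b) divided
  by binom(N, i), a normalized Krawtchouk value. The boundary is harmless: the truncated
  \<open>i - 1\<close> at i = 0 and the out-of-range index at i = N both carry the factor 0.\<close>

primrec bernstein_ratio :: "nat \<Rightarrow> nat \<Rightarrow> nat \<Rightarrow> real" where
  "bernstein_ratio 0 N i = 1"
| "bernstein_ratio (Suc b) N i = 
     real i / real N * bernstein_ratio b (N - 1) (i - 1) - (1 - real i / real N) * bernstein_ratio b (N - 1) i"

lemma of_nat_eq_Const: "of_nat k = Const (real k)"
  by (induction k) (simp_all add: Const_add)

text \<open>Multiplication by p - m turns coefficients a_i in degree N - 1 into a_(i-1) - a_i.
  Divided by binom(N, i) this is the recursion, because binom(N, i) i/N = binom(N-1, i-1) and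
  binom(N, i) (1 - i/N) = binom(N-1, i).\<close>

lemma bernstein_expansion:
  fixes p m :: "'n rpoly"
  assumes "b \<le> N"
  shows "(p - m) ^ b * (p + m) ^ (N - b) = 
    (\<Sum>i\<le>N. Const (real (N choose i) * bernstein_ratio b N i) * (p ^ i * m ^ (N - i)))"
  using assms
proof (induction b arbitrary: N)
  case 0
  then show ?case
    by (simp add: binomial_ring of_nat_eq_Const mult.assoc)
next
  case (Suc b)
  then obtain K where N: "N = Suc K" and K: "b \<le> K"
    by (cases N) auto
  define a where "a i = real (K choose i) * bernstein_ratio b K i" for i
  have coeff0: "real (N choose 0) * bernstein_ratio (Suc b) N 0 = - a 0"
    by (simp add: a_def N)
  have coeff: "real (N choose Suc i) * bernstein_ratio (Suc b) N (Suc i) = a i - a (Suc i)" for i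
  proof -
    have "real (Suc i) * real (N choose Suc i) = real N * real (K choose i)"
      using Suc_times_binomial[of i K] unfolding N by (metis of_nat_mult)
    then have 1: "real (N choose Suc i) * (real (Suc i) / real N) = real (K choose i)"
      by (simp add: N field_simps)
    have "real (K choose i) + real (K choose Suc i) = real (N choose Suc i)"
      by (simp add: N)
    with 1 have 2: "real (N choose Suc i) * (1 - real (Suc i) / real N) = real (K choose Suc i)"
      by (simp add: right_diff_distrib)
    have "real (N choose Suc i) * bernstein_ratio (Suc b) N (Suc i) = 
       (real (N choose Suc i) * (real (Suc i) / real N)) * bernstein_ratio b K i - 
       (real (N choose Suc i) * (1 - real (Suc i) / real N)) * bernstein_ratio b K (Suc i)"
    proof -
      have "x * (u * v - w * z) = (x * u) * v - (x * w) * z" for x u v w z :: real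
        by (simp add: algebra_simps)
      then show ?thesis
        by (simp only: bernstein_ratio.simps N diff_Suc_1)
    qed
    then show ?thesis
      unfolding 1 2 a_def .
  qed
  \<comment> \<open>This extends the second sum below from K to N.\<close>
  have "a (Suc K) = 0"
    by (simp add: a_def)
  have "(p - m) ^ Suc b * (p + m) ^ (N - Suc b) = (p - m) * ((p - m) ^ b * (p + m) ^ (K - b))"
    by (simp add: N mult.assoc)
  also have "\<dots> = (p - m) * (\<Sum>i\<le>K. Const (a i) * (p ^ i * m ^ (K - i)))"
    using Suc.IH[OF K] by (simp add: a_def)
  also have "\<dots> = (\<Sum>i\<le>K. Const (a i) * (p ^ Suc i * m ^ (N - Suc i))) - 
      (\<Sum>i\<le>K. Const (a i) * (p ^ i * m ^ (N - i)))"
    by (simp add: N left_diff_distrib right_diff_distrib sum_subtractf sum_distrib_left Suc_diff_le mult_ac)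
  also have "(\<Sum>i\<le>K. Const (a i) * (p ^ i * m ^ (N - i))) = (\<Sum>i\<le>N. Const (a i) * (p ^ i * m ^ (N - i)))"
    using \<open>a (Suc K) = 0\<close> by (simp add: N)
  also have "\<dots> = Const (a 0) * m ^ N + (\<Sum>i\<le>K. Const (a (Suc i)) * (p ^ Suc i * m ^ (N - Suc i)))"
    unfolding N by (subst sum.atMost_Suc_shift) simp
  also have "(\<Sum>i\<le>K. Const (a i) * (p ^ Suc i * m ^ (N - Suc i))) - \<dots> = 
     Const (- a 0) * m ^ N + (\<Sum>i\<le>K. Const (a i - a (Suc i)) * (p ^ Suc i * m ^ (N - Suc i)))"
    by (simp add: Const_minus Const_diff left_diff_distrib sum_subtractf)
  also have "\<dots> = (\<Sum>i\<le>N. Const (real (N choose i) * bernstein_ratio (Suc b) N i) * (p ^ i * m ^ (N - i)))"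
    unfolding N sum.atMost_Suc_shift unfolding N[symmetric] coeff coeff0 by simp
  finally show ?case .
qed

text \<open>With l = i/N and x = 2l - 1 the recursion reads l u - (1 - l) v, and l x^b - (1 - l) x^b
  = x^(b+1). Whenever their factor is nonzero, u and v belong to nodes of level N - 1 within 2/(N-1)
  of x, so each is x^b + O(1/N).\<close>

lemma bernstein_ratio_approx:
  "\<exists>C\<ge>0. \<forall>N>b. \<forall>i\<le>N. \<bar>bernstein_ratio b N i - (2 * real i / real N - 1) ^ b\<bar> \<le> C / real N"
proof (induction b)
  case 0
  then show ?case by (intro exI[of _ 0]) auto
next
  case (Suc b)
  then obtain C where C: "0 \<le> C" 
    and IH: "\<And>N i. b < N \<Longrightarrow> i \<le> N \<Longrightarrow> \<bar>bernstein_ratio b N i - (2 * real i / real N - 1) ^ b\<bar> \<le> C / real N"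
    by blast
  \<comment> \<open>In \<open>near\<close>, the induction hypothesis and the Lipschitz constant b of
    the power on [-1, 1] give (C + 2b)/(N-1); then 1/(N-1) \<le> 2/N doubles the constant.\<close>
  define D where "D = 2 * C + 4 * real b"
  have "\<bar>bernstein_ratio (Suc b) N i - (2 * real i / real N - 1) ^ Suc b\<bar> \<le> D / real N"
    if N: "Suc b < N" and i: "i \<le> N" for N i
  proof -
    define x where "x = 2 * real i / real N - 1"
    define l where "l = real i / real N"
    have l: "0 \<le> l" "l \<le> 1" "x = 2 * l - 1"
      using i by (auto simp: l_def x_def divide_le_eq)
    then have x: "\<bar>x\<bar> \<le> 1"
      by auto
    have abs_diff_triangle: "\<bar>u - w\<bar> \<le> d + e'" if "\<bar>u - v\<bar> \<le> d" "\<bar>v - w\<bar> \<le> e" "e \<le> e'" for u v w d e e' :: real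
      using that by linarith
    have near: "\<bar>bernstein_ratio b (N - 1) k - x ^ b\<bar> \<le> D / real N" 
      if k: "k \<le> N - 1" and xk: "\<bar>2 * real k / real (N - 1) - 1 - x\<bar> \<le> 2 / real (N - 1)" for k
    proof -
      define y where "y = 2 * real k / real (N - 1) - 1"
      have y: "\<bar>y\<bar> \<le> 1"
        using k N by (auto simp: y_def abs_le_iff divide_simps)
      have inv: "1 / real (N - 1) \<le> 2 / real N"
        using N by (simp add: field_simps of_nat_diff)
      have "\<bar>bernstein_ratio b (N - 1) k - y ^ b\<bar> \<le> C / real (N - 1)"
        unfolding y_def using k N by (intro IH) auto
      moreover have "\<bar>y ^ b - x ^ b\<bar> \<le> real b * \<bar>y - x\<bar>"
        using norm_power_diff[of y x b] x y by simp
      moreover have "real b * \<bar>y - x\<bar> \<le> real b * (2 / real (N - 1))"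
        using xk by (intro mult_left_mono) (auto simp: y_def)
      ultimately have "\<bar>bernstein_ratio b (N - 1) k - x ^ b\<bar> \<le> C / real (N - 1) + real b * (2 / real (N - 1))"
        by (rule abs_diff_triangle)
      also have "\<dots> = (C + 2 * real b) * (1 / real (N - 1))"
        by (simp add: add_divide_distrib)
      also have "\<dots> \<le> (C + 2 * real b) * (2 / real N)"
        using inv C by (intro mult_left_mono) auto
      finally show ?thesis
        by (simp add: D_def algebra_simps add_divide_distrib)
    qed
    have A: "\<bar>l * (bernstein_ratio b (N - 1) (i - 1) - x ^ b)\<bar> \<le> l * (D / real N)"
    proof (cases "i = 0")
      case False
      have "\<bar>bernstein_ratio b (N - 1) (i - 1) - x ^ b\<bar> \<le> D / real N"
      proof (rule near)
        have "2 * real (i - 1) / real (N - 1) - 1 - x = - 2 * (1 - l) / real (N - 1)"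
          using False i N by (simp add: x_def l_def of_nat_diff field_simps)
        then have "\<bar>2 * real (i - 1) / real (N - 1) - 1 - x\<bar> = 2 * (1 - l) / real (N - 1)"
          using l N by (simp add: abs_mult)
        also have "\<dots> \<le> 2 / real (N - 1)"
          using l by (intro divide_right_mono) auto
        finally show "\<bar>2 * real (i - 1) / real (N - 1) - 1 - x\<bar> \<le> 2 / real (N - 1)" .
      qed (use i in simp)
      then show ?thesis
        unfolding abs_mult abs_of_nonneg[OF l(1)] using l(1) by (rule mult_left_mono)
    qed (simp add: l_def)
    have B: "\<bar>(1 - l) * (bernstein_ratio b (N - 1) i - x ^ b)\<bar> \<le> (1 - l) * (D / real N)"
    proof (cases "i = N")
      case False
      have "\<bar>bernstein_ratio b (N - 1) i - x ^ b\<bar> \<le> D / real N"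
      proof (rule near)
        have "2 * real i / real (N - 1) - 1 - x = 2 * l / real (N - 1)"
          using i N by (simp add: x_def l_def of_nat_diff field_simps)
        then have "\<bar>2 * real i / real (N - 1) - 1 - x\<bar> = 2 * l / real (N - 1)"
          using l N by simp
        also have "\<dots> \<le> 2 / real (N - 1)"
          using l by (intro divide_right_mono) auto
        finally show "\<bar>2 * real i / real (N - 1) - 1 - x\<bar> \<le> 2 / real (N - 1)" .
      qed (use i False in simp)
      moreover have "0 \<le> 1 - l"
        using l(2) by simp
      ultimately show ?thesis
        unfolding abs_mult by (simp only: abs_of_nonneg mult_left_mono)
    qed (use N in \<open>simp add: l_def\<close>)
    have "bernstein_ratio (Suc b) N i - x ^ Suc b = 
        l * (bernstein_ratio b (N - 1) (i - 1) - x ^ b) - (1 - l) * (bernstein_ratio b (N - 1) i - x ^ b)"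
      by (simp add: l_def[symmetric] l(3) algebra_simps)
    then have "\<bar>bernstein_ratio (Suc b) N i - x ^ Suc b\<bar> \<le> l * (D / real N) + (1 - l) * (D / real N)"
      using A B by linarith
    also have "\<dots> = D / real N"
      by (simp only: distrib_right[symmetric]) simp
    finally show ?thesis
      unfolding x_def .
  qed
  moreover have "0 \<le> D"
    using C by (simp add: D_def)
  ultimately show ?case
    by blast
qed

lemma eventually_bernstein_ratio_approx:
  assumes "0 < \<zeta>" "0 < R"
  shows "\<forall>\<^sub>F N in sequentially. \<forall>i\<le>N. 
    \<bar>R ^ b * bernstein_ratio b N i - (R * (2 * real i / real N - 1)) ^ b\<bar> \<le> \<zeta>"
proof -
  obtain C where C: "0 \<le> C" 
    and *: "\<And>N i. b < N \<Longrightarrow> i \<le> N \<Longrightarrow> \<bar>bernstein_ratio b N i - (2 * real i / real N - 1) ^ b\<bar> \<le> C / real N"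
    using bernstein_ratio_approx[of b] by blast
  have "(\<lambda>N. R ^ b * C / real N) \<longlonglongrightarrow> 0"
    by (intro lim_const_over_n)
  then have "\<forall>\<^sub>F N in sequentially. R ^ b * C / real N < \<zeta>"
    using assms(1) by (rule order_tendstoD)
  then show ?thesis
    using eventually_gt_at_top[of b]
  proof eventually_elim
    case (elim N)
    show ?case
    proof (intro allI impI)
      fix i assume "i \<le> N"
      have "\<bar>R ^ b * bernstein_ratio b N i - (R * (2 * real i / real N - 1)) ^ b\<bar> = 
          R ^ b * \<bar>bernstein_ratio b N i - (2 * real i / real N - 1) ^ b\<bar>"
        using assms(2) by (simp add: power_mult_distrib abs_mult flip: right_diff_distrib)
      also have "\<dots> \<le> R ^ b * (C / real N)"
        using assms(2) elim \<open>i \<le> N\<close> by (intro mult_left_mono *) auto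
      finally show "\<bar>R ^ b * bernstein_ratio b N i - (R * (2 * real i / real N - 1)) ^ b\<bar> \<le> \<zeta>"
        using elim by simp
    qed
  qed
qed

text \<open>With p = (c + s)^2 and m = (c - s)^2 one has 2cs = (p - m)/2 and c^2 + s^2 = (p + m)/2,
  so every factor has a Bernstein expansion in p and m. The powers of c^2 + s^2 bring all terms to
  degree N per variable. Multiplying out gives a combination of the squares
  \<open>P \<iota> ^ 2\<close>, with coefficients nonnegative by \<open>nonneg\<close> up to
  positive binomial factors.\<close>

lemma sos_bernstein:
  fixes c s :: "'n::finite \<Rightarrow> 'n rpoly" and a :: "'b \<Rightarrow> real" and \<beta> :: "'b \<Rightarrow> 'n \<Rightarrow> nat"
  assumes le: "\<And>x j. x \<in> F \<Longrightarrow> \<beta> x j \<le> N"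
    and nonneg: "\<And>\<iota>. (\<And>j. \<iota> j \<le> N) \<Longrightarrow> 
      0 \<le> (\<Sum>x\<in>F. a x * (\<Prod>j\<in>UNIV. R ^ \<beta> x j * bernstein_ratio (\<beta> x j) N (\<iota> j)))"
  shows "sos (\<Sum>x\<in>F. Const (a x) * 
    (\<Prod>j\<in>UNIV. (Const R * (2 * c j * s j)) ^ \<beta> x j * (c j ^ 2 + s j ^ 2) ^ (N - \<beta> x j)))"
proof -
  define A where "A = (PiE UNIV (\<lambda>_. {..N}) :: ('n \<Rightarrow> nat) set)"
  define P where "P \<iota> = (\<Prod>j\<in>UNIV. (c j + s j) ^ \<iota> j * (c j - s j) ^ (N - \<iota> j))" for \<iota> :: "'n \<Rightarrow> nat"
  define B where "B \<iota> = (\<Prod>j\<in>UNIV. real (N choose \<iota> j) / 2 ^ N)" for \<iota> :: "'n \<Rightarrow> nat"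
  define r where "r x \<iota> = (\<Prod>j\<in>UNIV. R ^ \<beta> x j * bernstein_ratio (\<beta> x j) N (\<iota> j))" for x and \<iota> :: "'n \<Rightarrow> nat"
  have one: "(Const R * (2 * c j * s j)) ^ b * (c j ^ 2 + s j ^ 2) ^ (N - b) =
      (\<Sum>i\<le>N. Const (real (N choose i) / 2 ^ N * (R ^ b * bernstein_ratio b N i)) * 
         ((c j + s j) ^ i * (c j - s j) ^ (N - i)) ^ 2)" if b: "b \<le> N" for b j
  proof -
    define p m where "p = (c j + s j) ^ 2" and "m = (c j - s j) ^ 2"
    have 1: "2 * c j * s j = Const (1/2) * (p - m)"
      by (rule Const_half_mult) (simp add: p_def m_def power2_eq_square algebra_simps)
    have 2: "c j ^ 2 + s j ^ 2 = Const (1/2) * (p + m)"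
      by (rule Const_half_mult) (simp add: p_def m_def power2_eq_square algebra_simps)
    have half: "(1/2 :: real) ^ b * (1/2) ^ (N - b) = 1 / 2 ^ N"
      using b by (simp add: power_divide flip: power_add)
    have "(Const R * (2 * c j * s j)) ^ b * (c j ^ 2 + s j ^ 2) ^ (N - b) = 
       Const (R ^ b * ((1/2) ^ b * (1/2) ^ (N - b))) * ((p - m) ^ b * (p + m) ^ (N - b))"
      unfolding 1 2 by (simp only: power_mult_distrib Const_mult Const_power mult_ac)
    also have "\<dots> = Const (R ^ b / 2 ^ N) * (\<Sum>i\<le>N. Const (real (N choose i) * bernstein_ratio b N i) * (p ^ i * m ^ (N - i)))"
      unfolding half bernstein_expansion[OF b] by simp
    also have "\<dots> = (\<Sum>i\<le>N. Const (real (N choose i) / 2 ^ N * (R ^ b * bernstein_ratio b N i)) * (p ^ i * m ^ (N - i)))"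
    proof -
      have "Const (R ^ b / 2 ^ N) * (Const (real (N choose i) * bernstein_ratio b N i) * q) =
        Const (real (N choose i) / 2 ^ N * (R ^ b * bernstein_ratio b N i)) * q" for i and q :: "'n rpoly"
      proof -
        have "R ^ b / 2 ^ N * (real (N choose i) * bernstein_ratio b N i) =
            real (N choose i) / 2 ^ N * (R ^ b * bernstein_ratio b N i)"
          by simp
        then show ?thesis
          by (simp only: mult.assoc[symmetric] Const_mult[symmetric])
      qed
      then show ?thesis
        by (simp add: sum_distrib_left)
    qed
    finally show ?thesis
      by (simp add: p_def m_def power_mult_distrib power_mult[symmetric] mult.commute)
  qed
  have "(\<Prod>j\<in>UNIV. (Const R * (2 * c j * s j)) ^ \<beta> x j * (c j ^ 2 + s j ^ 2) ^ (N - \<beta> x j)) = 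
      (\<Sum>\<iota>\<in>A. Const (B \<iota> * r x \<iota>) * P \<iota> ^ 2)" if "x \<in> F" for x
  proof -
    define T where "T i j = Const (real (N choose i) / 2 ^ N * (R ^ \<beta> x j * bernstein_ratio (\<beta> x j) N i)) *
         ((c j + s j) ^ i * (c j - s j) ^ (N - i)) ^ 2" for i j
    have "(\<Prod>j\<in>UNIV. (Const R * (2 * c j * s j)) ^ \<beta> x j * (c j ^ 2 + s j ^ 2) ^ (N - \<beta> x j)) = 
        (\<Prod>j\<in>UNIV. \<Sum>i\<le>N. T i j)"
      unfolding T_def by (intro prod.cong refl one le that)
    also have "\<dots> = (\<Sum>\<iota>\<in>A. \<Prod>j\<in>UNIV. T (\<iota> j) j)"
      unfolding A_def by (intro prod_sum_PiE) auto
    also have "\<dots> = (\<Sum>\<iota>\<in>A. Const (B \<iota> * r x \<iota>) * P \<iota> ^ 2)"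
      unfolding T_def B_def r_def P_def prod.distrib[symmetric] Const_prod prod_power_distrib ..
    finally show ?thesis .
  qed
  then have "(\<Sum>x\<in>F. Const (a x) * 
    (\<Prod>j\<in>UNIV. (Const R * (2 * c j * s j)) ^ \<beta> x j * (c j ^ 2 + s j ^ 2) ^ (N - \<beta> x j))) = 
    (\<Sum>x\<in>F. \<Sum>\<iota>\<in>A. Const (B \<iota> * (a x * r x \<iota>)) * P \<iota> ^ 2)"
    by (simp add: sum_distrib_left Const_mult mult_ac)
  \<comment> \<open>Exchanging the sums collects all contributions to one square; single
    contributions may be negative.\<close>
  also have "\<dots> = (\<Sum>\<iota>\<in>A. Const (B \<iota> * (\<Sum>x\<in>F. a x * r x \<iota>)) * P \<iota> ^ 2)"
    by (subst sum.swap) (simp only: Const_sum sum_distrib_left sum_distrib_right)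
  finally show ?thesis
    unfolding A_def r_def B_def using nonneg
    by (auto intro!: sos_sum sos_Const_square mult_nonneg_nonneg prod_nonneg simp: PiE_iff)
qed

subsection \<open>The theorem\<close>

lemma prod_single:
  "finite A \<Longrightarrow> (\<Prod>j\<in>A. Poly_Mapping.single (\<beta> j) (1 :: real)) = Poly_Mapping.single (\<Sum>j\<in>A. \<beta> j) 1"
  by (induction A rule: finite_induct) (simp_all add: mult_single)

lemma Var_power: "Var j ^ k = Poly_Mapping.single (Poly_Mapping.single j k) 1"
  by (induction k) (simp_all add: Var_def mult_single flip: single_add)

lemma monomial_lookup:
  fixes \<beta> :: "'n::finite \<Rightarrow>\<^sub>0 nat"
  shows "monomial (Poly_Mapping.lookup \<beta>) = Poly_Mapping.single \<beta> 1"
proof -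
  have "(\<Sum>j\<in>UNIV. Poly_Mapping.single j (Poly_Mapping.lookup \<beta> j)) = \<beta>"
    by (intro poly_mapping_eqI) (simp add: lookup_sum lookup_single when_def sum.delta)
  then show ?thesis
    by (simp add: monomial_def Var_power prod_single)
qed

lemma rpoly_eq_sum_monomials:
  fixes f :: "'n::finite rpoly"
  shows "f = (\<Sum>\<beta>\<in>Poly_Mapping.keys f. Const (Poly_Mapping.lookup f \<beta>) * monomial (Poly_Mapping.lookup \<beta>))"
proof (intro poly_mapping_eqI)
  fix \<gamma>
  have "Poly_Mapping.lookup (\<Sum>\<beta>\<in>Poly_Mapping.keys f. Const (Poly_Mapping.lookup f \<beta>) * monomial (Poly_Mapping.lookup \<beta>)) \<gamma>
    = (\<Sum>\<beta>\<in>Poly_Mapping.keys f. if \<beta> = \<gamma> then Poly_Mapping.lookup f \<beta> else 0)"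
    by (simp add: monomial_lookup lookup_sum Const_def mult_single lookup_single when_def)
  then show "Poly_Mapping.lookup f \<gamma> = Poly_Mapping.lookup (\<Sum>\<beta>\<in>Poly_Mapping.keys f. Const (Poly_Mapping.lookup f \<beta>) * monomial (Poly_Mapping.lookup \<beta>)) \<gamma>"
    by (simp add: sum.delta in_keys_iff)
qed

text \<open>Continuity at \<zeta> = 0; it converts a tolerance for a product over the variables into
  one for each factor in \<open>abs_prod_diff_le\<close>.\<close>

lemma power_add_diff_small:
  fixes C \<xi> :: real
  assumes "0 < \<xi>"
  shows "\<exists>\<zeta>>0. (C + \<zeta>) ^ n - C ^ n \<le> \<xi>"
proof -
  have "((\<lambda>\<zeta>. (C + \<zeta>) ^ n - C ^ n) \<longlongrightarrow> (C + 0) ^ n - C ^ n) (at_right 0)"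
    by (intro tendsto_intros)
  then have "\<forall>\<^sub>F \<zeta> in at_right 0. (C + \<zeta>) ^ n - C ^ n < \<xi>"
    using assms by (intro order_tendstoD) auto
  then have "\<forall>\<^sub>F \<zeta> in at_right 0. 0 < \<zeta> \<and> (C + \<zeta>) ^ n - C ^ n < \<xi>"
    using eventually_at_right_less[of 0] by eventually_elim simp
  then obtain \<zeta> where "0 < \<zeta>" "(C + \<zeta>) ^ n - C ^ n < \<xi>"
    by (auto dest!: eventually_happens)
  then show ?thesis
    by (auto intro: less_imp_le)
qed

text \<open>There are finitely many monomials in f, each dominated by a multiple of
  \<open>exp_sum r\<close> for large r; the sum of these multiples is the threshold for
  \<open>l\<close>.\<close>

lemma sos_add_large_exp_sum:
  fixes f :: "'n::finite rpoly"
  shows "\<exists>r0 l0. 0 \<le> l0 \<and> (\<forall>r l. r0 \<le> r \<longrightarrow> l0 \<le> l \<longrightarrow> sos (f + Const l * exp_sum r))"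
proof -
  obtain \<rho> h where \<rho>: "0 < \<rho>" and *: "\<And>(\<kappa> :: 'n \<Rightarrow> nat) c r \<eta>. \<lbrakk>0 \<le> \<eta>; \<bar>c\<bar> \<le> \<eta> * (\<Prod>j\<in>UNIV. weight \<rho> (\<kappa> j));
      \<And>j. h * \<kappa> j \<le> r\<rbrakk> \<Longrightarrow> 
     dominated (Const c * monomial \<kappa>) (Const (2 * \<eta> * (\<Prod>j\<in>UNIV. (1/2) ^ \<kappa> j)) * exp_sum r)"
    using dominated_monomial[where 'n = 'n] by metis
  define F where "F = Poly_Mapping.keys f"
  \<comment> \<open>Makes the coefficient hypothesis of the monomial bound an equality.\<close>
  define \<eta> where "\<eta> \<beta> = \<bar>Poly_Mapping.lookup f \<beta>\<bar> / (\<Prod>j\<in>UNIV. weight \<rho> (Poly_Mapping.lookup \<beta> j))" for \<beta> :: "'n \<Rightarrow>\<^sub>0 nat"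
  define C where "C \<beta> = 2 * \<eta> \<beta> * (\<Prod>j\<in>UNIV. (1/2) ^ Poly_Mapping.lookup \<beta> j)" for \<beta> :: "'n \<Rightarrow>\<^sub>0 nat"
  define r0 where "r0 = (\<Sum>\<beta>\<in>F. \<Sum>j\<in>UNIV. h * Poly_Mapping.lookup \<beta> j)"
  have pos: "0 < (\<Prod>j\<in>UNIV. weight \<rho> (Poly_Mapping.lookup \<beta> j))" for \<beta> :: "'n \<Rightarrow>\<^sub>0 nat"
    using weight_pos[OF \<rho>] by (intro prod_pos) auto
  have r0: "h * Poly_Mapping.lookup \<beta> j \<le> r0" if "\<beta> \<in> F" for \<beta> j
  proof -
    have "h * Poly_Mapping.lookup \<beta> j \<le> (\<Sum>j\<in>UNIV. h * Poly_Mapping.lookup \<beta> j)"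
      by (rule member_le_sum) auto
    also have "\<dots> \<le> r0"
      unfolding r0_def using that by (intro member_le_sum) (auto simp: F_def)
    finally show ?thesis .
  qed
  have \<eta>: "0 \<le> \<eta> \<beta>" for \<beta>
    unfolding \<eta>_def using pos by (intro divide_nonneg_pos) auto
  have C: "0 \<le> sum C F"
    unfolding C_def using \<eta> by (intro sum_nonneg mult_nonneg_nonneg prod_nonneg) auto
  have "sos (f + Const l * exp_sum r)" if r: "r0 \<le> r" and l: "sum C F \<le> l" for r l
  proof -
    have "dominated (\<Sum>\<beta>\<in>F. Const (Poly_Mapping.lookup f \<beta>) * monomial (Poly_Mapping.lookup \<beta>)) 
        (\<Sum>\<beta>\<in>F. Const (C \<beta>) * exp_sum r)"
    proof (intro dominated_sum)
      fix \<beta> assume "\<beta> \<in> F"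
      show "dominated (Const (Poly_Mapping.lookup f \<beta>) * monomial (Poly_Mapping.lookup \<beta>)) (Const (C \<beta>) * exp_sum r)"
        unfolding C_def
      proof (rule *)
        show "\<bar>Poly_Mapping.lookup f \<beta>\<bar> \<le> \<eta> \<beta> * (\<Prod>j\<in>UNIV. weight \<rho> (Poly_Mapping.lookup \<beta> j))"
          using pos[of \<beta>] by (simp add: \<eta>_def less_imp_neq[symmetric])
        show "h * Poly_Mapping.lookup \<beta> j \<le> r" for j
          using r0[OF \<open>\<beta> \<in> F\<close>] r by (rule order_trans)
      qed (rule \<eta>)
    qed
    then have "sos (Const (sum C F) * exp_sum r + f)"
      unfolding F_def rpoly_eq_sum_monomials[of f, symmetric]
      by (simp add: dominated_def Const_sum sum_distrib_right)
    moreover have "sos (Const (l - sum C F) * (exp_sum r :: 'n rpoly))"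
      using l by (intro sos_Const_mult sos_exp_sum) simp
    ultimately have "sos ((Const (sum C F) * exp_sum r + f) + Const (l - sum C F) * exp_sum r)"
      by (rule sos_add)
    then show ?thesis
      by (simp add: Const_diff algebra_simps)
  qed
  then show ?thesis
    using C by blast
qed

text \<open>The constants are chosen in the order \<delta>, \<eta>, R, \<zeta>, N, r, which is
  possible because the coefficient bound obtained for R is uniform in N. With E =
  \<open>exp_sum r\<close>, the conclusion is f + \<epsilon> E = Q + (\<delta> E - (Q - (f +
  \<delta>))) + \<delta> (E - 1), a sum of three sums of squares.\<close>

lemma sos_add_small_exp_sum:
  fixes f :: "'n::finite rpoly"
  assumes f_nonneg: "\<And>x :: real ^ 'n. 0 \<le> eval_poly f x" and "0 < \<epsilon>"
  shows "\<exists>r. sos (f + Const \<epsilon> * exp_sum r)"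
proof -
  obtain \<rho> h where \<rho>: "0 < \<rho>" and dom: "\<forall>B (e :: ('n \<Rightarrow> nat) \<Rightarrow> real) r \<eta>. 0 \<le> \<eta> \<longrightarrow> h * B \<le> r \<longrightarrow>
     (\<forall>\<kappa> \<in> PiE UNIV (\<lambda>_. {..B}). \<bar>e \<kappa>\<bar> \<le> \<eta> * (\<Prod>j\<in>UNIV. weight \<rho> (\<kappa> j))) \<longrightarrow>
     dominated (\<Sum>\<kappa> \<in> PiE UNIV (\<lambda>_. {..B}). Const (e \<kappa>) * monomial \<kappa>)
       (Const (2 * \<eta> * 2 ^ CARD('n)) * exp_sum r)"
    using dominated_sum_monomials[where 'n = 'n] by (elim exE conjE)
  let ?n = "CARD('n)"
  let ?lk = "Poly_Mapping.lookup"
  \<comment> \<open>\<open>f\<close> together with the constant \<open>\<delta>\<close>, whose exponent \<open>0\<close> is listed separately as \<open>None\<close>\<close>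
  define F where "F = insert None (Some ` Poly_Mapping.keys f)"
  \<comment> \<open>One half of \<epsilon> pays for the added constant, the other for the
    approximation error.\<close>
  define \<delta> where "\<delta> = \<epsilon> / 2"
  define a where "a x = (case x of None \<Rightarrow> \<delta> | Some \<beta> \<Rightarrow> ?lk f \<beta>)" for x
  define ex where "ex x = (case x of None \<Rightarrow> (\<lambda>_. 0) | Some \<beta> \<Rightarrow> ?lk \<beta>)" for x :: "('n \<Rightarrow>\<^sub>0 nat) option"
  have F: "finite F"
    by (simp add: F_def)
  have sum_F: "(\<Sum>x\<in>F. g x) = g None + (\<Sum>\<beta>\<in>Poly_Mapping.keys f. g (Some \<beta>))" for g :: "_ \<Rightarrow> 'c::comm_monoid_add"
    by (simp add: F_def sum.reindex)
  have f_plus: "(\<Sum>x\<in>F. Const (a x) * monomial (ex x)) = Const \<delta> + f"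
    using rpoly_eq_sum_monomials[of f, symmetric] by (simp add: sum_F a_def ex_def) (simp add: monomial_def)
  have \<delta>: "0 < \<delta>"
    using \<open>0 < \<epsilon>\<close> by (simp add: \<delta>_def)
  have f_ge: "\<delta> \<le> (\<Sum>x\<in>F. a x * (\<Prod>j\<in>UNIV. y j ^ ex x j))" for y :: "'n \<Rightarrow> real"
    using f_nonneg[of "\<chi> j. y j"] by (simp add: sum_F a_def ex_def eval_poly_def)
  define L where "L = (\<Sum>x\<in>F. \<bar>a x\<bar>)"
  have L: "0 < L"
    using \<delta> by (simp add: L_def sum_F a_def add_pos_nonneg sum_nonneg)
  define d where "d = (\<Sum>x\<in>F. \<Sum>j\<in>UNIV. ex x j)"
  have d: "ex x j \<le> d" if "x \<in> F" for x j
  proof -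
    have "ex x j \<le> (\<Sum>j\<in>UNIV. ex x j)"
      by (rule member_le_sum) auto
    also have "\<dots> \<le> d"
      unfolding d_def using that F by (intro member_le_sum) auto
    finally show ?thesis .
  qed
  \<comment> \<open>A common bound for the monomials x^b with b \<le> d on the scale of
    \<open>weight\<close>.\<close>
  define C where "C = (\<Sum>b\<le>d. 1 / weight \<rho> b)"
  have w: "0 < weight \<rho> b" for b
    using \<rho> by (rule weight_pos)
  have C: "(if k = b then 1 else 0) \<le> C * weight \<rho> k" if "b \<le> d" for b k
  proof (cases "k = b")
    case True
    have "1 / weight \<rho> b \<le> C"
      unfolding C_def using that w by (intro member_le_sum) (auto simp: less_imp_le)
    then show ?thesis
      using True w[of k] by (simp add: field_simps)
  next
    case False
    have "0 \<le> C"
      unfolding C_def using w by (intro sum_nonneg) (auto simp: less_imp_le)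
    then show ?thesis
      using False w[of k] by simp
  qed
  have C_nonneg: "0 \<le> C"
    unfolding C_def using w by (intro sum_nonneg) (auto simp: less_imp_le)
  \<comment> \<open>Solves L (2 \<xi> 2^n) = \<delta>: the constant in \<open>dom\<close>,
    accumulated over all terms of f + \<delta>, is then \<delta>.\<close>
  define \<xi> where "\<xi> = \<delta> / (L * 2 * 2 ^ ?n)"
  have "0 < \<xi>"
    using \<delta> L by (simp add: \<xi>_def)
  then obtain \<eta> where \<eta>: "0 < \<eta>" "(C + \<eta>) ^ ?n - C ^ ?n \<le> \<xi>"
    using power_add_diff_small by blast
  have "\<forall>\<^sub>F R in at_top. \<forall>b\<in>{..d}. \<forall>M N. 1 \<le> M \<longrightarrow> N \<le> M \<longrightarrow> 
    majorized \<eta> \<rho> (smult R (sin_poly (1 / (2 * R * real M)) (2 * M)) ^ b * 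
      ((1 + [:0, 1 / (2 * R * real M):] ^ 2) ^ M) ^ N - monom 1 b)"
    using \<rho> \<eta>(1) by (intro eventually_ball_finite ballI eventually_majorized_power) auto
  then have "\<forall>\<^sub>F R in at_top. 1 \<le> R \<and> (\<forall>b\<in>{..d}. \<forall>M N. 1 \<le> M \<longrightarrow> N \<le> M \<longrightarrow> 
    majorized \<eta> \<rho> (smult R (sin_poly (1 / (2 * R * real M)) (2 * M)) ^ b * 
      ((1 + [:0, 1 / (2 * R * real M):] ^ 2) ^ M) ^ N - monom 1 b))"
    by (intro eventually_conj eventually_ge_at_top)
  then obtain R :: real where R: "1 \<le> R" and majorized: "\<And>b M N. b \<le> d \<Longrightarrow> 1 \<le> M \<Longrightarrow> N \<le> M \<Longrightarrow> 
    majorized \<eta> \<rho> (smult R (sin_poly (1 / (2 * R * real M)) (2 * M)) ^ b * 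
      ((1 + [:0, 1 / (2 * R * real M):] ^ 2) ^ M) ^ N - monom 1 b)"
    by (auto dest!: eventually_happens)
  have "0 < \<delta> / L"
    using \<delta> L by simp
  \<comment> \<open>On the box, R^d bounds each factor y_j^b with b \<le> d. Tolerance \<zeta> per
    factor keeps each product within \<delta>/L, hence the whole sum within \<delta>.\<close>
  then obtain \<zeta> where \<zeta>: "0 < \<zeta>" "(R ^ d + \<zeta>) ^ ?n - (R ^ d) ^ ?n \<le> \<delta> / L"
    using power_add_diff_small by blast
  have "\<forall>\<^sub>F N in sequentially. \<forall>b\<in>{..d}. \<forall>i\<le>N. 
    \<bar>R ^ b * bernstein_ratio b N i - (R * (2 * real i / real N - 1)) ^ b\<bar> \<le> \<zeta>"
    using R \<zeta>(1) by (intro eventually_ball_finite ballI eventually_bernstein_ratio_approx) auto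
  then have "\<forall>\<^sub>F N in sequentially. max 1 d \<le> N \<and> (\<forall>b\<in>{..d}. \<forall>i\<le>N. 
    \<bar>R ^ b * bernstein_ratio b N i - (R * (2 * real i / real N - 1)) ^ b\<bar> \<le> \<zeta>)"
    by (intro eventually_conj eventually_ge_at_top)
  then obtain N where N: "1 \<le> N" "d \<le> N" and ratio: "\<And>b i. b \<le> d \<Longrightarrow> i \<le> N \<Longrightarrow> 
    \<bar>R ^ b * bernstein_ratio b N i - (R * (2 * real i / real N - 1)) ^ b\<bar> \<le> \<zeta>"
    by (auto dest!: eventually_happens)
  define t where "t = 1 / (2 * R * real N)"
  \<comment> \<open>The substitute for x^b: the b-th power of the scaled sine, homogenized by the
    power N - b of the squared modulus.\<close>
  define G where "G b = smult R (sin_poly t (2 * N)) ^ b * ((1 + [:0, t:] ^ 2) ^ N) ^ (N - b)" for b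
  have G: "\<bar>coeff (G b) k - (if k = b then 1 else 0)\<bar> \<le> \<eta> * weight \<rho> k" if "b \<le> d" for b k
    using majorized[OF that N(1), of "N - b"] by (auto simp: majorized_def G_def t_def eq_commute[of k b])
  define Q where "Q = (\<Sum>x\<in>F. Const (a x) * (\<Prod>j\<in>UNIV. univ j (G (ex x j))))"

  have "sos Q"
  proof -
    have "sos (\<Sum>x\<in>F. Const (a x) * (\<Prod>j\<in>UNIV. 
        (Const R * (2 * univ j (cos_poly t N) * univ j (sin_poly t N))) ^ ex x j * 
        (univ j (cos_poly t N) ^ 2 + univ j (sin_poly t N) ^ 2) ^ (N - ex x j)))"
    proof (rule sos_bernstein)
      show "ex x j \<le> N" if "x \<in> F" for x j
        using d[OF that] N(2) by (rule order_trans)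
      fix \<iota> :: "'n \<Rightarrow> nat" assume \<iota>: "\<And>j. \<iota> j \<le> N"
      \<comment> \<open>A grid point of the box. The Bernstein coefficient differs by at most
        \<delta> from the value of f + \<delta> there, which is at least \<delta>.\<close>
      define y where "y j = R * (2 * real (\<iota> j) / real N - 1)" for j
      have y: "\<bar>y j\<bar> \<le> R" for j
      proof -
        have "\<bar>2 * real (\<iota> j) / real N - 1\<bar> \<le> 1"
          using \<iota>[of j] N(1) by (auto simp: abs_le_iff divide_simps)
        then have "R * \<bar>2 * real (\<iota> j) / real N - 1\<bar> \<le> R * 1"
          using R by (intro mult_left_mono) auto
        then show ?thesis
          using R by (simp add: y_def abs_mult)
      qed
      have "\<bar>(\<Sum>x\<in>F. a x * (\<Prod>j\<in>UNIV. R ^ ex x j * bernstein_ratio (ex x j) N (\<iota> j))) - 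
          (\<Sum>x\<in>F. a x * (\<Prod>j\<in>UNIV. y j ^ ex x j))\<bar> \<le> (\<Sum>x\<in>F. \<bar>a x\<bar> * (\<delta> / L))"
        unfolding sum_subtractf[symmetric] right_diff_distrib[symmetric]
      proof (intro order_trans[OF sum_abs] sum_mono)
        fix x assume x: "x \<in> F"
        have "\<bar>(\<Prod>j\<in>UNIV. R ^ ex x j * bernstein_ratio (ex x j) N (\<iota> j)) - (\<Prod>j\<in>UNIV. y j ^ ex x j)\<bar>
          \<le> ((R ^ d + \<zeta>) ^ ?n - (R ^ d) ^ ?n) * (\<Prod>j\<in>(UNIV :: 'n set). 1)"
        proof (rule abs_prod_diff_le)
          fix j
          show "\<bar>R ^ ex x j * bernstein_ratio (ex x j) N (\<iota> j) - y j ^ ex x j\<bar> \<le> \<zeta> * 1"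
            using ratio[OF d[OF x] \<iota>] by (simp add: y_def)
          have "\<bar>y j ^ ex x j\<bar> \<le> R ^ ex x j"
            unfolding power_abs using y by (intro power_mono) auto
          also have "\<dots> \<le> R ^ d"
            using d[OF x] R by (intro power_increasing) auto
          finally show "\<bar>y j ^ ex x j\<bar> \<le> R ^ d * 1"
            by simp
        qed (use \<zeta> R in auto)
        also have "\<dots> \<le> \<delta> / L"
          using \<zeta>(2) by simp
        finally show "\<bar>a x * ((\<Prod>j\<in>UNIV. R ^ ex x j * bernstein_ratio (ex x j) N (\<iota> j)) - (\<Prod>j\<in>UNIV. y j ^ ex x j))\<bar>
          \<le> \<bar>a x\<bar> * (\<delta> / L)"
          unfolding abs_mult by (intro mult_left_mono) auto
      qed
      also have "\<dots> = \<delta>"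
        using L by (simp add: L_def flip: sum_distrib_right sum_divide_distrib)
      finally show "0 \<le> (\<Sum>x\<in>F. a x * (\<Prod>j\<in>UNIV. R ^ ex x j * bernstein_ratio (ex x j) N (\<iota> j)))"
        using f_ge[of y] by linarith
    qed
    also have "(\<Sum>x\<in>F. Const (a x) * (\<Prod>j\<in>UNIV. 
        (Const R * (2 * univ j (cos_poly t N) * univ j (sin_poly t N))) ^ ex x j * 
        (univ j (cos_poly t N) ^ 2 + univ j (sin_poly t N) ^ 2) ^ (N - ex x j))) = Q"
    proof -
      have "Const R * (2 * univ j (cos_poly t N) * univ j (sin_poly t N)) = univ j (smult R (sin_poly t (2 * N)))" for j :: 'n
        by (simp only: univ_smult univ_mult sin_poly_double univ_2)
      moreover have "univ j (cos_poly t N) ^ 2 + univ j (sin_poly t N) ^ 2 = univ j ((1 + [:0, t:] ^ 2) ^ N)" for j :: 'n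
        by (simp add: univ_power univ_add flip: cos_sin_poly_squares)
      ultimately show ?thesis
        by (simp add: Q_def G_def univ_mult univ_power)
    qed
    finally show ?thesis .
  qed

  \<comment> \<open>Bounds all exponents and degrees involved, so that both products below are
    expanded over one index set.\<close>
  define B where "B = d + (\<Sum>b\<le>d. degree (G b))"
  define r where "r = h * B"
  have degG: "degree (G b) \<le> B" if "b \<le> d" for b
    using member_le_sum[of b "{..d}" "\<lambda>b. degree (G b)"] that by (simp add: B_def)
  have "dominated ((\<Prod>j\<in>UNIV. univ j (G (ex x j))) - monomial (ex x)) (Const (2 * \<xi> * 2 ^ ?n) * exp_sum r)"
    if x: "x \<in> F" for x
  proof -
    \<comment> \<open>The second product, of Kronecker deltas, is the coefficient of
      \<open>monomial (ex x)\<close> at \<kappa>.\<close>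
    define e where "e \<kappa> = (\<Prod>j\<in>UNIV. coeff (G (ex x j)) (\<kappa> j)) - (\<Prod>j\<in>UNIV. if \<kappa> j = ex x j then 1 else 0)" for \<kappa>
    have "(\<Prod>j\<in>UNIV. univ j (G (ex x j))) = 
        (\<Sum>\<kappa> \<in> PiE UNIV (\<lambda>_. {..B}). Const (\<Prod>j\<in>UNIV. coeff (G (ex x j)) (\<kappa> j)) * monomial \<kappa>)"
      by (intro prod_univ_eq_sum degG d x)
    moreover have "monomial (ex x) = (\<Prod>j\<in>UNIV. univ j (monom 1 (ex x j)))"
      by (simp add: monomial_def univ_monom)
    moreover have "(\<Prod>j\<in>UNIV. univ j (monom 1 (ex x j))) = 
        (\<Sum>\<kappa> \<in> PiE UNIV (\<lambda>_. {..B}). Const (\<Prod>j\<in>UNIV. coeff (monom 1 (ex x j)) (\<kappa> j)) * monomial \<kappa>)"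
      using d[OF x] by (intro prod_univ_eq_sum) (auto simp: degree_monom_eq B_def intro: trans_le_add1)
    ultimately have eq: "(\<Prod>j\<in>UNIV. univ j (G (ex x j))) - monomial (ex x) = 
        (\<Sum>\<kappa> \<in> PiE UNIV (\<lambda>_. {..B}). Const (e \<kappa>) * monomial \<kappa>)"
      by (simp add: e_def Const_diff left_diff_distrib sum_subtractf eq_commute[of "ex x _"])
    show ?thesis
      unfolding eq
    proof (rule dom[THEN spec, THEN spec, THEN spec, THEN spec, THEN mp, THEN mp, THEN mp])
      show "\<forall>\<kappa>\<in>PiE UNIV (\<lambda>_. {..B}). \<bar>e \<kappa>\<bar> \<le> \<xi> * (\<Prod>j\<in>UNIV. weight \<rho> (\<kappa> j))"
      proof
        fix \<kappa> :: "'n \<Rightarrow> nat"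
        have "\<bar>e \<kappa>\<bar> \<le> ((C + \<eta>) ^ ?n - C ^ ?n) * (\<Prod>j\<in>UNIV. weight \<rho> (\<kappa> j))"
          unfolding e_def
        proof (rule abs_prod_diff_le)
          fix j
          show "\<bar>coeff (G (ex x j)) (\<kappa> j) - (if \<kappa> j = ex x j then 1 else 0)\<bar> \<le> \<eta> * weight \<rho> (\<kappa> j)"
            using G[OF d[OF x]] .
          show "\<bar>if \<kappa> j = ex x j then 1 else 0\<bar> \<le> C * weight \<rho> (\<kappa> j)"
            using C[OF d[OF x, of j], of "\<kappa> j"] by auto
        qed (use \<eta>(1) C_nonneg w in \<open>auto simp: less_imp_le\<close>)
        also have "\<dots> \<le> \<xi> * (\<Prod>j\<in>UNIV. weight \<rho> (\<kappa> j))"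
          using \<eta>(2) w by (intro mult_right_mono prod_nonneg) (auto simp: less_imp_le)
        finally show "\<bar>e \<kappa>\<bar> \<le> \<xi> * (\<Prod>j\<in>UNIV. weight \<rho> (\<kappa> j))" .
      qed
    qed (use \<open>0 < \<xi>\<close> in \<open>auto simp: r_def\<close>)
  qed
  then have "dominated (\<Sum>x\<in>F. Const (a x) * ((\<Prod>j\<in>UNIV. univ j (G (ex x j))) - monomial (ex x))) 
     (\<Sum>x\<in>F. Const \<bar>a x\<bar> * (Const (2 * \<xi> * 2 ^ ?n) * exp_sum r))"
    using \<open>0 < \<xi>\<close> by (intro dominated_sum dominated_Const_mult sos_Const_mult sos_exp_sum) auto
  moreover have "(\<Sum>x\<in>F. Const (a x) * ((\<Prod>j\<in>UNIV. univ j (G (ex x j))) - monomial (ex x))) = Q - (Const \<delta> + f)"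
    by (simp only: Q_def f_plus[symmetric] right_diff_distrib sum_subtractf)
  moreover have "(\<Sum>x\<in>F. Const \<bar>a x\<bar> * (Const (2 * \<xi> * 2 ^ ?n) * exp_sum r)) = Const \<delta> * (exp_sum r :: 'n rpoly)"
  proof -
    have "L * (2 * \<xi> * 2 ^ ?n) = \<delta>"
      using L by (simp add: \<xi>_def)
    then show ?thesis
      by (simp only: L_def sum_distrib_right[symmetric] mult.assoc[symmetric] Const_sum[symmetric] Const_mult[symmetric])
  qed
  ultimately have "sos (Const \<delta> * exp_sum r - (Q - (Const \<delta> + f)))"
    by (simp add: dominated_def)
  moreover have "sos (Const \<delta> * (exp_sum r - 1 :: 'n rpoly))"
    using \<delta> by (intro sos_Const_mult sos_exp_sum_diff_1) auto
  ultimately have "sos (Q + (Const \<delta> * exp_sum r - (Q - (Const \<delta> + f))) + Const \<delta> * (exp_sum r - 1))"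
    using \<open>sos Q\<close> by (intro sos_add)
  moreover have "Const \<epsilon> = (Const \<delta> + Const \<delta> :: 'n rpoly)"
    by (simp add: \<delta>_def flip: Const_add)
  ultimately have "sos (f + Const \<epsilon> * exp_sum r)"
    by (simp add: algebra_simps)
  then show ?thesis ..
qed

section \<open>The l1 norm of the perturbation\<close>

lemma l1_norm_eq_sum:
  assumes "finite A" "Poly_Mapping.keys f \<subseteq> A"
  shows "l1_norm f = (\<Sum>\<alpha>\<in>A. \<bar>Poly_Mapping.lookup f \<alpha>\<bar>)"
  unfolding l1_norm_def using assms by (intro sum.mono_neutral_left) (auto simp: in_keys_iff)

lemma l1_norm_nonneg: "0 \<le> l1_norm f"
  by (simp add: l1_norm_def sum_nonneg)

lemma l1_norm_add_le: "l1_norm (f + g) \<le> l1_norm f + l1_norm g"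
proof -
  let ?A = "Poly_Mapping.keys f \<union> Poly_Mapping.keys g"
  have "l1_norm (f + g) = (\<Sum>\<alpha>\<in>?A. \<bar>Poly_Mapping.lookup (f + g) \<alpha>\<bar>)"
    using keys_add[of f g] by (intro l1_norm_eq_sum) auto
  also have "\<dots> \<le> (\<Sum>\<alpha>\<in>?A. \<bar>Poly_Mapping.lookup f \<alpha>\<bar> + \<bar>Poly_Mapping.lookup g \<alpha>\<bar>)"
    by (intro sum_mono) (simp add: lookup_add)
  also have "\<dots> = l1_norm f + l1_norm g"
    by (simp add: sum.distrib l1_norm_eq_sum[of ?A f] l1_norm_eq_sum[of ?A g])
  finally show ?thesis .
qed

lemma l1_norm_sum_le: "l1_norm (\<Sum>x\<in>A. f x) \<le> (\<Sum>x\<in>A. l1_norm (f x))"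
proof (induction A rule: infinite_finite_induct)
  case (insert x A)
  then show ?case
    using l1_norm_add_le[of "f x" "sum f A"] by simp
qed (simp_all add: l1_norm_def)

lemma l1_norm_single [simp]: "l1_norm (Poly_Mapping.single \<alpha> c) = \<bar>c\<bar>"
  by (simp add: l1_norm_def)

lemma l1_norm_uminus: "l1_norm (- f) = l1_norm f"
  by (simp add: l1_norm_def)

text \<open>Each variable contributes at most \<epsilon> times a partial sum of the series for e.
  The bound is uniform in r, so convergence holds however r depends on \<epsilon>.\<close>

lemma l1_norm_exp_sum_le:
  fixes \<epsilon> :: real
  assumes "0 \<le> \<epsilon>"
  shows "l1_norm (Const \<epsilon> * exp_sum r :: 'n::finite rpoly) \<le> \<epsilon> * (real CARD('n) * exp 1)"
proof -
  have "l1_norm (Const \<epsilon> * exp_sum r :: 'n rpoly) \<le> 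
     (\<Sum>k=0..r. \<Sum>j\<in>UNIV. l1_norm (Const \<epsilon> * (Const (1 / fact k) * Var (j :: 'n) ^ (2 * k))))"
    unfolding exp_sum_def sum_distrib_left
    by (intro order_trans[OF l1_norm_sum_le] sum_mono l1_norm_sum_le)
  also have "\<dots> = (\<Sum>k=0..r. \<Sum>j\<in>(UNIV :: 'n set). \<epsilon> / fact k)"
    using assms by (simp add: Const_def Var_power mult_single)
  also have "\<dots> = \<epsilon> * (real CARD('n) * (\<Sum>k\<le>r. 1 / fact k))"
    by (simp add: atLeast0AtMost sum_distrib_left mult_ac)
  also have "\<dots> \<le> \<epsilon> * (real CARD('n) * exp 1)"
  proof -
    have "(\<Sum>k\<le>r. 1 / fact k :: real) \<le> suminf (\<lambda>k. 1 / fact k)"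
      using summable_exp[of "1 :: real"] by (intro sum_le_suminf) (auto simp: divide_inverse)
    also have "\<dots> = exp 1"
      by (simp add: exp_def divide_inverse)
    finally show ?thesis
      using assms by (intro mult_left_mono) auto
  qed
  finally show ?thesis .
qed

theorem theorem4p1:
  fixes f :: "'n::finite rpoly"
  assumes "0 \<le> global_inf f"
    and "\<forall>x :: real ^ 'n. global_inf f \<le> eval_poly f x"
  shows "(\<exists>(r0::nat) (l0::real). 0 \<le> l0 \<and>
            (\<forall>(r::nat) (l::real). r0 \<le> r \<longrightarrow> l0 \<le> l \<longrightarrow> sos (f + Const l * exp_sum r))) \<and>
         (\<forall>\<epsilon>::real. 0 < \<epsilon> \<longrightarrow> (\<exists>r::nat. sos (f + Const \<epsilon> * exp_sum r))) \<and>
         (\<forall>r :: real \<Rightarrow> nat.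
            (\<forall>\<epsilon>>0. sos (f + Const \<epsilon> * exp_sum (r \<epsilon>))) \<longrightarrow>
            ((\<lambda>\<epsilon>. l1_norm (f - (f + Const \<epsilon> * exp_sum (r \<epsilon>)))) \<longlongrightarrow> 0) (at_right 0))"
proof (intro conjI allI impI)
  show "\<exists>(r0::nat) (l0::real). 0 \<le> l0 \<and>
            (\<forall>(r::nat) (l::real). r0 \<le> r \<longrightarrow> l0 \<le> l \<longrightarrow> sos (f + Const l * exp_sum r))"
    by (rule sos_add_large_exp_sum)
next
  fix \<epsilon> :: real assume "0 < \<epsilon>"
  then show "\<exists>r::nat. sos (f + Const \<epsilon> * exp_sum r)"
    using assms by (intro sos_add_small_exp_sum) (auto intro: order_trans)
next
  fix r :: "real \<Rightarrow> nat"
  show "((\<lambda>\<epsilon>. l1_norm (f - (f + Const \<epsilon> * exp_sum (r \<epsilon>)))) \<longlongrightarrow> 0) (at_right 0)"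
  proof (rule tendsto_sandwich[where f = "\<lambda>_. 0"])
    show "((\<lambda>\<epsilon>. \<epsilon> * (real CARD('n) * exp 1)) \<longlongrightarrow> 0) (at_right 0)"
      by (auto intro!: tendsto_eq_intros)
    show "\<forall>\<^sub>F \<epsilon> in at_right 0. l1_norm (f - (f + Const \<epsilon> * exp_sum (r \<epsilon>))) \<le> \<epsilon> * (real CARD('n) * exp 1)"
      using eventually_at_right_less[of 0]
      by eventually_elim (simp add: l1_norm_uminus l1_norm_exp_sum_le)
  qed (simp_all add: l1_norm_nonneg)
qed

end
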